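(* Let $2\le r\le s$ be integers. The Turán graph $T(s,r)$ is inducibility diverse if and only if it is complete (i.e. $r=s$).
   Context: All graphs are finite and simple. $T(s,r)$ is the complete $r$-partite graph on $s$ vertices whose part sizes differ by at most one. For graphs $F,G$, $P(F,G)$ is the number of $|V(F)|$-subsets of $V(G)$ inducing a subgraph isomorphic to $F$, and $p(F,G)=P(F,G)/\binom{|V(G)|}{|V(F)|}$. For $k\ge 2$, $i_k(F,n)$ is the maximum of $p(F,G)$ over all $n$-vertex graphs $G$ not containing $K_k$ as a subgraph, and $i_k(F)=\lim_{n\to\infty}i_k(F,n)$ (the limit exists). $F$ is inducibility diverse if for every $k\ge 2$ there exists $m>k$ such that $i_k(F)<i_m(F)$. *)

theory Defs
  imports
    Complex_Main
    "HOL-Library.Disjoint_Sets"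
    "Graph_Theory.Graph_Theory"
begin

text \<open>
  A finite simple graph is a \<^term>\<open>pair_graph\<close>: a finite vertex set with a symmetric irreflexive
  set of arcs, an edge \<open>uv\<close> being represented by the two arcs \<open>(u, v)\<close> and \<open>(v, u)\<close>.
\<close>

definition induced_copies :: "'a pair_pre_digraph \<Rightarrow> 'b pair_pre_digraph \<Rightarrow> nat" where
  "induced_copies F G =
     card {S. S \<subseteq> pverts G \<and> card S = card (pverts F)
            \<and> digraph_iso (with_proj F) (with_proj G \<restriction> S)}"

definition induced_density :: "'a pair_pre_digraph \<Rightarrow> 'b pair_pre_digraph \<Rightarrow> real" where
  "induced_density F G =
     real (induced_copies F G) / real (card (pverts G) choose card (pverts F))"

definition clique_free :: "nat \<Rightarrow> 'a pair_pre_digraph \<Rightarrow> bool" where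
  "clique_free k G \<longleftrightarrow> \<not> (\<exists>H. subgraph H (with_proj G) \<and> complete_digraph k H)"

text \<open>
  Every \<open>n\<close>-vertex graph is isomorphic to one whose vertices are natural numbers, so the maximum
  may be taken over the latter. There are infinitely many of them, but their densities are
  fractions in \<open>[0, 1]\<close> with a common denominator, so the maximum is over a finite set. It is
  nonempty for \<open>k \<ge> 2\<close>, the only case used.
\<close>
definition inducibility_at :: "nat \<Rightarrow> 'a pair_pre_digraph \<Rightarrow> nat \<Rightarrow> real" where
  "inducibility_at k F n =
     Max {induced_density F G | G :: nat pair_pre_digraph.
            pair_graph G \<and> card (pverts G) = n \<and> clique_free k G}"

definition inducibility :: "nat \<Rightarrow> 'a pair_pre_digraph \<Rightarrow> real" where
  "inducibility k F = lim (\<lambda>n. inducibility_at k F n)"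

definition inducibility_diverse :: "'a pair_pre_digraph \<Rightarrow> bool" where
  "inducibility_diverse F \<longleftrightarrow> (\<forall>k\<ge>2. \<exists>m>k. inducibility k F < inducibility m F)"

text \<open>
  \<open>F\<close> is a copy of the Turan graph \<open>T(s, r)\<close>. The parts are the members of a partition in the sense
  of \<^const>\<open>partition_on\<close>, hence nonempty, which is no restriction when \<open>r \<le> s\<close>.
\<close>
definition turan_graph :: "nat \<Rightarrow> nat \<Rightarrow> 'a pair_pre_digraph \<Rightarrow> bool" where
  "turan_graph s r F \<longleftrightarrow> pair_graph F \<and> card (pverts F) = s \<and>
     (\<exists>P. partition_on (pverts F) P \<and> card P = r \<and>
          (\<forall>A\<in>P. \<forall>B\<in>P. card A \<le> card B + 1) \<and>
          parcs F = {(u, v). u \<in> pverts F \<and> v \<in> pverts F \<and> \<not> (\<exists>A\<in>P. u \<in> A \<and> v \<in> A)})"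

lemma turan_graph_exists:
  assumes "1 \<le> r" "r \<le> s"
  shows "\<exists>F :: nat pair_pre_digraph. turan_graph s r F"
proof -
  define C where "C j = {i. i < s \<and> i mod r = j}" for j
  define P where "P = C ` {..<r}"
  define F where "F = \<lparr>pverts = {..<s}, parcs = {(u, v). u < s \<and> v < s \<and> u mod r \<noteq> v mod r}\<rparr>"
  have fin: "finite (C j)" for j by (simp add: C_def)
  have self: "j \<in> C j" if "j < r" for j using that assms by (auto simp: C_def)
  have bal: "card (C i) \<le> card (C j) + 1" if "i < r" "j < r" for i j
  proof -
    have ge: "i + r \<le> x \<and> (x - i) mod r = 0" if "x \<in> C i - {i}" for x
    proof -
      have x: "x mod r = i" "x \<noteq> i" using that by (auto simp: C_def)
      then have "x \<ge> r" using \<open>i < r\<close> by (metis mod_less not_less)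
      have "x = r * (x div r) + i" using x by (metis mult_div_mod_eq)
      moreover have "x div r \<ge> 1"
        using \<open>x \<ge> r\<close> assms by (simp add: Suc_leI div_greater_zero_iff)
      then have "r * 1 \<le> r * (x div r)" by (rule mult_le_mono2)
      ultimately show ?thesis
        by (metis add.commute add_diff_cancel_right' mod_mult_self1_is_0 mult.right_neutral nat_add_left_cancel_le)
    qed
    have "card (C i - {i}) \<le> card (C j)"
    proof (rule card_inj_on_le)
      show "inj_on (\<lambda>x. (x - i - r) + j) (C i - {i})"
        using ge by (intro inj_onI) (metis add.commute add_right_cancel diff_diff_left le_add_diff_inverse2)
      show "(\<lambda>x. (x - i - r) + j) ` (C i - {i}) \<subseteq> C j"
      proof (rule image_subsetI)
        fix x assume x: "x \<in> C i - {i}"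
        then have g: "i + r \<le> x" "(x - i) mod r = 0" using ge by auto
        then have "(x - i - r) mod r = 0" by (simp add: le_mod_geq)
        then have "((x - i - r) + j) mod r = j"
          using \<open>j < r\<close> by (metis add_0 mod_add_left_eq mod_less)
        moreover have "(x - i - r) + j < s" using x g \<open>j < r\<close> by (auto simp: C_def)
        ultimately show "(x - i - r) + j \<in> C j" by (simp add: C_def)
      qed
    qed (rule fin)
    then show ?thesis using self[OF \<open>i < r\<close>] fin[of i] by (simp add: card_Diff_singleton)
  qed
  have "pair_graph F"
  proof unfold_locales
    show "finite (parcs F)"
      by (rule finite_subset[of _ "{..<s} \<times> {..<s}"]) (auto simp: F_def)
  qed (auto simp: F_def symmetric_def sym_def)
  moreover have "partition_on {..<s} P"
    using self assms unfolding partition_on_def P_def C_def disjoint_def by fastforce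
  moreover have "inj_on C {..<r}"
  proof (rule inj_onI)
    fix x y assume xy: "x \<in> {..<r}" "C x = C y"
    with self[of x] have "x \<in> C x \<inter> C y" by auto
    then show "x = y" by (auto simp: C_def)
  qed
  then have "card P = r" by (simp add: P_def card_image)
  moreover have "\<forall>A\<in>P. \<forall>B\<in>P. card A \<le> card B + 1"
    using bal by (auto simp: P_def)
  moreover have "(\<exists>A\<in>P. u \<in> A \<and> v \<in> A) \<longleftrightarrow> u mod r = v mod r" if "u < s" "v < s" for u v
    using that assms by (auto simp: P_def C_def)
  then have "parcs F = {(u, v). u \<in> pverts F \<and> v \<in> pverts F \<and> \<not> (\<exists>A\<in>P. u \<in> A \<and> v \<in> A)}"
    unfolding F_def by fastforce
  moreover have "pverts F = {..<s}" by (simp add: F_def)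
  ultimately have "turan_graph s r F"
    unfolding turan_graph_def by (intro conjI exI[of _ P]) simp_all
  then show ?thesis ..
qed

end

theory Submission
  imports Defs "HOL-Library.FuncSet"
begin

text \<open>
  Fix a complete multipartite graph \<open>F\<close> with \<open>s\<close> vertices and colour its vertices independently at
  random by the vertices of a host graph, according to weights \<open>y\<close> that sum to one. The density of
  induced copies of \<open>F\<close> in a large graph is, up to a constant factor and the negligible effect of
  coinciding colours, the probability that this colouring is a strong homomorphism, for uniform \<open>y\<close>.
  As in the Motzkin--Straus argument for cliques, moving weight between two non-adjacent host vertices
  is a convex operation (\<open>hom_density_shift_weight\<close>), because non-adjacent vertices of \<open>F\<close> are twins.
  So the weights can be concentrated on a clique, which in a \<open>K\<^sub>k\<close>-free host has at most \<open>k - 1\<close>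
  vertices. Conversely, a random \<open>(k - 1)\<close>-partite graph realises any given weights on a clique. Hence
  (\<open>inducibility_eq_max_hom_density\<close>) the inducibility of \<open>F\<close> among \<open>K\<^sub>k\<close>-free graphs is
  \<open>s! / |Aut F|\<close> times the supremum \<open>M (k - 1)\<close> of the density over all weights on a complete graph
  with \<open>k - 1\<close> vertices, and \<open>F\<close> is inducibility diverse exactly if \<open>M\<close> never stops growing.

  If \<open>F\<close> is complete, a strong homomorphism is an injective colouring. Two vertices collide with
  probability at least \<open>1 / N\<close>, and with uniform weights some pair collides with probability at most
  \<open>s\<^sup>2 / N\<close>. So \<open>M N\<close> is always below \<open>1\<close> but tends to \<open>1\<close>.

  If a Turan graph \<open>F\<close> is not complete, its balanced parts leave two cases. If every part has at
  least two vertices, a host vertex of small weight \<open>y\<close> contributes only \<open>O(y\<^sup>2)\<close>, while deleting it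
  and rescaling gains a proportion of order \<open>y\<close>; so \<open>M\<close> is eventually constant
  (\<open>max_hom_density_stable_if_parts_large\<close>). If every part has at most two vertices, the density is,
  for each pair of host vertices with fixed total weight, a convex function of the product of their
  weights (\<open>hom_density_pair_convex\<close>). Then a pair can be moved towards equality or merged without
  loss, so that only uniform weights on \<open>l\<close> host vertices matter (\<open>hom_density_le_uniform\<close>). Some
  two distinct vertices of \<open>F\<close> lie in the same part and must receive the same colour, which has
  probability \<open>1 / l\<close>, so large \<open>l\<close> are useless and \<open>M\<close> is again eventually constant
  (\<open>max_hom_density_stable_if_parts_small\<close>).
\<close>

section \<open>Strong homomorphisms into weighted graphs\<close>

definition strong_homs :: "'a set \<Rightarrow> 'a rel \<Rightarrow> 'b set \<Rightarrow> 'b rel \<Rightarrow> ('a \<Rightarrow> 'b) set" where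
  "strong_homs V E W D = {f \<in> V \<rightarrow>\<^sub>E W. \<forall>u\<in>V. \<forall>v\<in>V. (u, v) \<in> E \<longleftrightarrow> (f u, f v) \<in> D}"

text \<open>
  Colour the vertices in \<open>V\<close> independently at random by elements of \<open>W\<close>, according to the
  distribution \<open>y\<close>. The quantity \<open>hom_density V E W D y\<close> is then the probability that the colouring
  preserves both adjacency and non-adjacency, where two vertices of the same colour count as
  non-adjacent as soon as \<open>D\<close> is irreflexive. It is also the limiting density of \<open>(V, E)\<close>, up to a
  factor counting labellings, in large blow-ups of the graph \<open>(W, D)\<close> with part sizes proportional
  to \<open>y\<close>. The complete graph on \<open>W\<close> is written \<open>- Id\<close>; strong homomorphisms into it are the
  colourings in which exactly the adjacent pairs receive different colours.
\<close>

definition hom_density ::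
    "'a set \<Rightarrow> 'a rel \<Rightarrow> 'b set \<Rightarrow> 'b rel \<Rightarrow> ('b \<Rightarrow> real) \<Rightarrow> real" where
  "hom_density V E W D y = (\<Sum>f\<in>strong_homs V E W D. \<Prod>v\<in>V. y (f v))"

definition prob_weights :: "'b set \<Rightarrow> ('b \<Rightarrow> real) set" where
  "prob_weights W = {y. (\<forall>a\<in>W. 0 \<le> y a) \<and> sum y W = 1}"

lemma strong_homs_subset: "strong_homs V E W D \<subseteq> V \<rightarrow>\<^sub>E W"
  by (auto simp: strong_homs_def)

lemma finite_strong_homs [simp]:
  assumes "finite V" "finite W"
  shows "finite (strong_homs V E W D)"
  using finite_PiE[of V "\<lambda>_. W"] assms finite_subset[OF strong_homs_subset] by blast

lemma sum_prod_box:
  fixes y :: "'b \<Rightarrow> real"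
  assumes "finite V" "\<And>v. v \<in> V \<Longrightarrow> finite (B v)"
  shows "(\<Sum>f\<in>PiE V B. \<Prod>v\<in>V. y (f v)) = (\<Prod>v\<in>V. sum y (B v))"
  using prod_sum_PiE[of V B "\<lambda>_. y"] assms by simp

lemma sum_prod_all_maps:
  assumes "finite V" "finite W" "y \<in> prob_weights W"
  shows "(\<Sum>f\<in>V \<rightarrow>\<^sub>E W. \<Prod>v\<in>V. y (f v)) = 1"
  using sum_prod_box[of V "\<lambda>_. W" y] assms by (simp add: prob_weights_def)

lemma prod_weights_nonneg:
  assumes "y \<in> prob_weights W" "f \<in> V \<rightarrow>\<^sub>E W"
  shows "0 \<le> (\<Prod>v\<in>V. y (f v))"
  using assms by (intro prod_nonneg) (auto simp: prob_weights_def)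

lemma hom_density_le:
  assumes "finite V" "finite W" "y \<in> prob_weights W"
    and "strong_homs V E W D \<subseteq> T" "T \<subseteq> V \<rightarrow>\<^sub>E W"
  shows "hom_density V E W D y \<le> (\<Sum>f\<in>T. \<Prod>v\<in>V. y (f v))"
  unfolding hom_density_def
proof (rule sum_mono2)
  show "finite T" using assms finite_PiE[of V "\<lambda>_. W"] finite_subset by blast
  show "0 \<le> (\<Prod>v\<in>V. y (f v))" if "f \<in> T - strong_homs V E W D" for f
    using that assms by (intro prod_weights_nonneg[of y W]) auto
qed (rule assms)

lemma hom_density_le_1:
  assumes "finite V" "finite W" "y \<in> prob_weights W"
  shows "hom_density V E W D y \<le> 1"
  using hom_density_le[OF assms strong_homs_subset order_refl] sum_prod_all_maps[OF assms] by simp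

lemma sum_prod_both_at:
  assumes "finite V" "finite W" "y \<in> prob_weights W"
    and "u \<in> V" "v \<in> V" "u \<noteq> v" "i \<in> W"
  shows "(\<Sum>f\<in>{f \<in> V \<rightarrow>\<^sub>E W. f u = i \<and> f v = i}. \<Prod>z\<in>V. y (f z)) = (y i)\<^sup>2"
proof -
  let ?B = "\<lambda>z. if z \<in> {u, v} then {i} else W"
  have "{f \<in> V \<rightarrow>\<^sub>E W. f u = i \<and> f v = i} = PiE V ?B"
  proof (intro set_eqI)
    fix f
    show "f \<in> {f \<in> V \<rightarrow>\<^sub>E W. f u = i \<and> f v = i} \<longleftrightarrow> f \<in> PiE V ?B"
    proof
      assume "f \<in> {f \<in> V \<rightarrow>\<^sub>E W. f u = i \<and> f v = i}"
      then show "f \<in> PiE V ?B" by (auto simp: PiE_iff)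
    next
      assume f: "f \<in> PiE V ?B"
      have "f u = i" "f v = i" using PiE_mem[OF f, of u] PiE_mem[OF f, of v] assms by auto
      moreover have "f z \<in> W" if "z \<in> V" for z
        using PiE_mem[OF f that] \<open>i \<in> W\<close> by (cases "z \<in> {u, v}") auto
      ultimately show "f \<in> {f \<in> V \<rightarrow>\<^sub>E W. f u = i \<and> f v = i}"
        using f by (auto simp: PiE_iff)
    qed
  qed
  then have "(\<Sum>f\<in>{f \<in> V \<rightarrow>\<^sub>E W. f u = i \<and> f v = i}. \<Prod>z\<in>V. y (f z)) = (\<Prod>z\<in>V. sum y (?B z))"
    using assms by (simp only:) (rule sum_prod_box; simp)
  also have "\<dots> = (\<Prod>z\<in>{u, v}. sum y (?B z))"
    using assms by (intro prod.mono_neutral_right) (auto simp: prob_weights_def)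
  also have "\<dots> = (y i)\<^sup>2" using assms by (simp add: power2_eq_square)
  finally show ?thesis .
qed

text \<open>
  The probability that two given vertices receive the same colour. It enters in both directions: for
  adjacent vertices this event is forbidden, for distinct non-adjacent ones it is forced when the host
  is complete.
\<close>

lemma sum_prod_coincide:
  assumes "finite V" "finite W" "y \<in> prob_weights W" "u \<in> V" "v \<in> V" "u \<noteq> v"
  shows "(\<Sum>f\<in>{f \<in> V \<rightarrow>\<^sub>E W. f u = f v}. \<Prod>z\<in>V. y (f z)) = (\<Sum>i\<in>W. (y i)\<^sup>2)"
proof -
  let ?S = "{f \<in> V \<rightarrow>\<^sub>E W. f u = f v}"
  have "(\<Sum>f\<in>?S. \<Prod>z\<in>V. y (f z)) = (\<Sum>i\<in>W. \<Sum>f\<in>{f \<in> ?S. f u = i}. \<Prod>z\<in>V. y (f z))"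
    using assms by (intro sum.group[symmetric]) (auto intro: finite_subset[OF _ finite_PiE[of V "\<lambda>_. W"]])
  also have "\<dots> = (\<Sum>i\<in>W. (y i)\<^sup>2)"
  proof (rule sum.cong)
    fix i assume "i \<in> W"
    have "{f \<in> ?S. f u = i} = {f \<in> V \<rightarrow>\<^sub>E W. f u = i \<and> f v = i}" by auto
    then show "(\<Sum>f\<in>{f \<in> ?S. f u = i}. \<Prod>z\<in>V. y (f z)) = (y i)\<^sup>2"
      using sum_prod_both_at[OF assms \<open>i \<in> W\<close>] by simp
  qed simp
  finally show ?thesis .
qed

lemma sum_squares_ge_inverse_card:
  assumes "finite W" "y \<in> prob_weights W"
  shows "1 / real (card W) \<le> (\<Sum>i\<in>W. (y i)\<^sup>2)"
proof -
  let ?N = "real (card W)"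
  have "?N > 0" using assms by (auto simp: prob_weights_def card_gt_0_iff)
  have "0 \<le> (\<Sum>i\<in>W. (y i - 1 / ?N)\<^sup>2)" by (intro sum_nonneg) simp
  also have "\<dots> = (\<Sum>i\<in>W. (y i)\<^sup>2) - 2 / ?N * sum y W + ?N * (1 / ?N)\<^sup>2"
    by (simp add: power2_diff sum.distrib sum_subtractf algebra_simps
        flip: sum_divide_distrib sum_distrib_right)
  also have "\<dots> = (\<Sum>i\<in>W. (y i)\<^sup>2) - 1 / ?N"
    using \<open>?N > 0\<close> assms by (simp add: prob_weights_def power2_eq_square)
  finally show ?thesis by simp
qed

lemma hom_density_relabel:
  assumes "bij_betw g K L" "\<And>a b. a \<in> K \<Longrightarrow> b \<in> K \<Longrightarrow> (g a, g b) \<in> D' \<longleftrightarrow> (a, b) \<in> D"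
  shows "hom_density V E L D' y = hom_density V E K D (y \<circ> g)"
proof -
  have L: "L = g ` K" and inj: "inj_on g K" using assms(1) by (auto simp: bij_betw_def)
  let ?\<Phi> = "\<lambda>f. restrict (g \<circ> f) V"
  let ?\<Psi> = "\<lambda>f. restrict (the_inv_into K g \<circ> f) V"
  have inv: "the_inv_into K g (g a) = a" if "a \<in> K" for a
    using that inj by (rule the_inv_into_f_f[rotated])
  have inv2: "g (the_inv_into K g b) = b" "the_inv_into K g b \<in> K" if "b \<in> L" for b
    using that inj L inv by auto
  have "hom_density V E K D (y \<circ> g) = hom_density V E L D' y"
    unfolding hom_density_def
  proof (rule sum.reindex_bij_witness[of _ ?\<Psi> ?\<Phi>])
    fix f assume f: "f \<in> strong_homs V E K D"
    then have fK: "f v \<in> K" if "v \<in> V" for v using that by (auto simp: strong_homs_def)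
    show "?\<Psi> (?\<Phi> f) = f"
      using f fK inv by (intro ext) (auto simp: strong_homs_def restrict_def PiE_def extensional_def)
    show "?\<Phi> f \<in> strong_homs V E L D'"
      using f fK assms(2) L by (auto simp: strong_homs_def)
    show "(\<Prod>v\<in>V. y (?\<Phi> f v)) = (\<Prod>v\<in>V. (y \<circ> g) (f v))" by (intro prod.cong) auto
  next
    fix f assume f: "f \<in> strong_homs V E L D'"
    then have fL: "f v \<in> L" if "v \<in> V" for v using that by (auto simp: strong_homs_def)
    show "?\<Phi> (?\<Psi> f) = f"
      using f fL inv2 by (intro ext) (auto simp: strong_homs_def restrict_def PiE_def extensional_def)
    show "?\<Psi> f \<in> strong_homs V E K D"
      using f fL inv2 assms(2)[OF inv2(2) inv2(2)] by (auto simp: strong_homs_def)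
  qed
  then show ?thesis by simp
qed

text \<open>
  Colours of weight zero do not contribute, so weights may be spread over a larger host or restricted
  to their support.
\<close>

lemma hom_density_zero_extend:
  assumes "finite V" "finite W" "K \<subseteq> W" "\<And>a. a \<in> W - K \<Longrightarrow> y a = 0"
  shows "hom_density V E W D y = hom_density V E K D y"
  unfolding hom_density_def
proof (rule sum.mono_neutral_right)
  show "strong_homs V E K D \<subseteq> strong_homs V E W D"
    using assms(3) by (auto simp: strong_homs_def PiE_def Pi_def)
  show "\<forall>f\<in>strong_homs V E W D - strong_homs V E K D. (\<Prod>v\<in>V. y (f v)) = 0"
  proof
    fix f assume "f \<in> strong_homs V E W D - strong_homs V E K D"
    then obtain v where "v \<in> V" "f v \<in> W - K" by (auto simp: strong_homs_def PiE_def Pi_def)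
    then show "(\<Prod>v\<in>V. y (f v)) = 0" using assms by (intro prod_zero) auto
  qed
qed (use assms in simp)

section \<open>Optimal weights on a complete graph\<close>

definition max_hom_density :: "'a set \<Rightarrow> 'a rel \<Rightarrow> nat \<Rightarrow> real" where
  "max_hom_density V E N = (SUP y\<in>prob_weights {..<N}. hom_density V E {..<N} (- Id) y)"

lemma prob_weights_uniform:
  assumes "0 < N"
  shows "(\<lambda>_. 1 / real N) \<in> prob_weights {..<N}"
  using assms by (simp add: prob_weights_def)

lemma bdd_above_hom_density:
  assumes "finite V"
  shows "bdd_above (hom_density V E {..<N} (- Id) ` prob_weights {..<N::nat})"
  by (intro bdd_aboveI2[of _ _ 1] hom_density_le_1 assms) auto

lemma hom_density_clique_le_max:
  assumes "finite V" "finite K" "card K \<le> N" "z \<in> prob_weights K"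
  shows "hom_density V E K (- Id) z \<le> max_hom_density V E N"
proof -
  let ?l = "card K"
  obtain g where g: "bij_betw g {..<?l} K"
    using ex_bij_betw_nat_finite[OF assms(2)] by (auto simp: atLeast0LessThan)
  define y where "y i = (if i < ?l then z (g i) else 0)" for i
  have "sum y {..<N} = sum y {..<?l}"
    using assms(3) by (intro sum.mono_neutral_right) (auto simp: y_def)
  also have "\<dots> = (\<Sum>i<?l. z (g i))" by (intro sum.cong) (auto simp: y_def)
  also have "\<dots> = 1" using sum.reindex_bij_betw[OF g, of z] assms(4) by (simp add: prob_weights_def)
  finally have y: "y \<in> prob_weights {..<N}"
    using assms(4) bij_betwE[OF g] by (auto simp: prob_weights_def y_def)
  have "hom_density V E K (- Id) z = hom_density V E {..<?l} (- Id) (z \<circ> g)"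
    using g by (intro hom_density_relabel) (auto simp: bij_betw_def inj_on_def)
  also have "\<dots> = hom_density V E {..<?l} (- Id) y"
    unfolding hom_density_def y_def
    by (intro sum.cong prod.cong) (auto simp: strong_homs_def PiE_def Pi_def)
  also have "\<dots> = hom_density V E {..<N} (- Id) y"
    using assms by (intro hom_density_zero_extend[symmetric]) (auto simp: y_def)
  also have "\<dots> \<le> max_hom_density V E N"
    unfolding max_hom_density_def using y bdd_above_hom_density[OF assms(1)] by (rule cSUP_upper)
  finally show ?thesis .
qed

lemma max_hom_density_mono:
  assumes "finite V" "0 < M" "M \<le> N"
  shows "max_hom_density V E M \<le> max_hom_density V E N"
  unfolding max_hom_density_def[of V E M]
  using prob_weights_uniform[OF assms(2)] assms
  by (intro cSUP_least) (auto intro: hom_density_clique_le_max)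

section \<open>Symmetrisation to a clique\<close>

text \<open>
  Non-adjacency is an equivalence relation, whose classes are the parts. In particular two
  non-adjacent vertices have the same neighbours, which is what drives the symmetrisation below.
\<close>

locale complete_multipartite =
  fixes V :: "'a set" and E :: "'a rel"
  assumes finite_V: "finite V"
    and irrefl_E: "v \<in> V \<Longrightarrow> (v, v) \<notin> E"
    and sym_E: "u \<in> V \<Longrightarrow> v \<in> V \<Longrightarrow> (u, v) \<in> E \<Longrightarrow> (v, u) \<in> E"
    and nonadj_trans:
      "u \<in> V \<Longrightarrow> v \<in> V \<Longrightarrow> w \<in> V \<Longrightarrow> (u, v) \<notin> E \<Longrightarrow> (v, w) \<notin> E \<Longrightarrow> (u, w) \<notin> E"
begin

text \<open>
  The vertices of an independent set \<open>A\<close> are twins, so the adjacencies that \<open>E\<close> prescribes are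
  unchanged when a vertex of \<open>A\<close> is replaced by \<open>z\<close>; hence the whole of \<open>A\<close> may be sent where
  \<open>z\<close> goes.
\<close>

lemma hom_constant_on_independent:
  assumes f: "f \<in> strong_homs V E W D"
    and A: "A \<subseteq> V" "\<And>u v. u \<in> A \<Longrightarrow> v \<in> A \<Longrightarrow> (u, v) \<notin> E" "z \<in> A"
    and uv: "u \<in> V" "v \<in> V"
  shows "(u, v) \<in> E \<longleftrightarrow> ((if u \<in> A then f z else f u), (if v \<in> A then f z else f v)) \<in> D"
proof -
  define t where "t u = (if u \<in> A then z else u)" for u
  have z: "z \<in> V" using A by auto
  have twin: "t u \<in> V \<and> (u, t u) \<notin> E \<and> (t u, u) \<notin> E" if "u \<in> V" for u
    using that z A irrefl_E by (auto simp: t_def)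
  have "(u, v) \<in> E \<longleftrightarrow> (t u, t v) \<in> E"
    using twin[OF uv(1)] twin[OF uv(2)] uv nonadj_trans by meson
  also have "\<dots> \<longleftrightarrow> (f (t u), f (t v)) \<in> D"
    using f twin uv by (auto simp: strong_homs_def)
  finally show ?thesis by (auto simp: t_def if_distrib)
qed

text \<open>
  This is the Zykov and Motzkin--Straus symmetrisation step, in the form of a convexity estimate. Fix a
  colouring up to the choice between the non-adjacent colours \<open>a\<close> and \<open>b\<close> on the set \<open>A\<close> of
  vertices that receive one of them. If some choice that uses both colours is a strong homomorphism,
  then \<open>A\<close> is independent, and by twinness all \<open>2 ^ card A\<close> choices are; their total weight depends
  on \<open>y a + y b\<close> alone. Otherwise only the two constant choices can be strong homomorphisms, and
  their weights are proportional to \<open>p ^ card A\<close> and \<open>(1 - p) ^ card A\<close>, which are at most \<open>p\<close> and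
  \<open>1 - p\<close>. So giving all the weight to \<open>a\<close> or all of it to \<open>b\<close> is at least as good.
\<close>

lemma hom_density_shift_weight:
  assumes W: "finite W" "a \<in> W" "b \<in> W" "a \<noteq> b"
    and D: "\<And>c d. c \<in> W \<Longrightarrow> d \<in> W \<Longrightarrow> (c, d) \<in> D \<Longrightarrow> (d, c) \<in> D"
      "\<And>c. c \<in> W \<Longrightarrow> (c, c) \<notin> D" "(a, b) \<notin> D"
    and y: "\<And>c. c \<in> W \<Longrightarrow> 0 \<le> y c" "y a = p * S" "y b = (1 - p) * S"
    and p: "0 \<le> p" "p \<le> 1" "0 \<le> S"
  shows "hom_density V E W D y
    \<le> p * hom_density V E (W - {b}) D (y(a := S)) + (1 - p) * hom_density V E (W - {a}) D (y(b := S))"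
proof -
  \<comment> \<open>Renaming \<open>a\<close> to \<open>b\<close> lets both densities on the right be written as sums over the colourings
     in \<open>T\<close>, which avoid \<open>b\<close>. The colourings counted on the left are grouped by the element of
     \<open>T\<close> that results from merging \<open>b\<close> into \<open>a\<close>.\<close>
  define g where "g c = (if c = a then b else c)" for c
  define D1 where "D1 = {(c, d). (g c, g d) \<in> D}"
  define T where "T = V \<rightarrow>\<^sub>E W - {b}"
  define w where "w f = (\<Prod>v\<in>V. y (f v))" for f
  define wS where "wS \<theta> = (\<Prod>v\<in>V. (y(a := S)) (\<theta> v))" for \<theta>
  define H where "H = strong_homs V E W D"
  define Ha where "Ha = strong_homs V E (W - {b}) D"
  define Hb where "Hb = strong_homs V E (W - {b}) D1"
  define merge where "merge f = restrict (\<lambda>v. if f v = b then a else f v) V" for f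
  have ba: "(b, a) \<notin> D" using D W by blast
  have finT: "finite T" unfolding T_def using W finite_V by (intro finite_PiE) auto
  have finH: "finite H" unfolding H_def using W finite_V by simp
  have sub: "Ha \<subseteq> T" "Hb \<subseteq> T" unfolding Ha_def Hb_def T_def by (rule strong_homs_subset)+
  have bij: "bij_betw g (W - {b}) (W - {a})"
    unfolding bij_betw_def using W by (auto simp: inj_on_def g_def image_iff split: if_splits)
  have "hom_density V E (W - {a}) D (y(b := S)) = hom_density V E (W - {b}) D1 (y(b := S) \<circ> g)"
    using bij by (rule hom_density_relabel) (simp add: D1_def)
  also have "\<dots> = sum wS Hb"
    unfolding hom_density_def Hb_def wS_def using W
    by (intro sum.cong prod.cong) (auto simp: strong_homs_def g_def PiE_def Pi_def)
  finally have dens_b: "hom_density V E (W - {a}) D (y(b := S)) = sum wS Hb" .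
  have dens_a: "hom_density V E (W - {b}) D (y(a := S)) = sum wS Ha"
    unfolding hom_density_def Ha_def wS_def ..
  have wS_nonneg: "0 \<le> wS \<theta>" if "\<theta> \<in> T" for \<theta>
    unfolding wS_def using that y p by (intro prod_nonneg) (auto simp: T_def)

  have fibre: "sum w {f \<in> H. merge f = \<theta>}
      \<le> p * (if \<theta> \<in> Ha then wS \<theta> else 0) + (1 - p) * (if \<theta> \<in> Hb then wS \<theta> else 0)"
    if \<theta>: "\<theta> \<in> T" for \<theta>
  proof -
    define A where "A = {v \<in> V. \<theta> v = a}"
    have \<theta>b: "\<theta> v \<noteq> b" "\<theta> v \<in> W" if "v \<in> V" for v using \<theta> that by (auto simp: T_def)
    define B where "B v = (if \<theta> v = a then {a, b} else {\<theta> v})" for v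
    have box: "f \<in> PiE V B" if "f \<in> H" "merge f = \<theta>" for f
      using that by (auto simp: B_def merge_def H_def strong_homs_def PiE_iff)
    have off: "f v = \<theta> v" if "f \<in> PiE V B" "v \<in> V" "v \<notin> A" for f v
      using PiE_mem[OF that(1,2)] that(2,3) by (auto simp: A_def B_def)
    have on: "f v \<in> {a, b}" if "f \<in> PiE V B" "v \<in> A" for f v
      using PiE_mem[OF that(1), of v] that(2) by (auto simp: A_def B_def)
    have "sum w (PiE V B) = (\<Prod>v\<in>V. sum y (B v))"
      unfolding w_def using finite_V by (intro sum_prod_box) (auto simp: B_def)
    also have "\<dots> = wS \<theta>"
      unfolding wS_def using W y by (intro prod.cong) (auto simp: B_def algebra_simps)
    finally have total: "sum w (PiE V B) = wS \<theta>" .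
    have w_nonneg: "0 \<le> w f" if "f \<in> PiE V B" for f
      unfolding w_def
    proof (intro prod_nonneg ballI y)
      fix v assume "v \<in> V"
      then show "f v \<in> W" using PiE_mem[OF that \<open>v \<in> V\<close>] \<theta>b W by (auto simp: B_def split: if_splits)
    qed
    have mixed: "\<theta> \<in> Ha \<and> \<theta> \<in> Hb"
      if f: "f \<in> H" "merge f = \<theta>" and u: "u \<in> A" "f u = a" "v \<in> A" "f v = b" for f u v
    proof -
      have fB: "f \<in> PiE V B" using box f by blast
      have ind: "(x, x') \<notin> E" if "x \<in> A" "x' \<in> A" for x x'
      proof -
        have "(f x, f x') \<notin> D" using on[OF fB that(1)] on[OF fB that(2)] D(2,3) W ba by auto
        then show ?thesis using f(1) that by (auto simp: H_def strong_homs_def A_def)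
      qed
      have AV: "A \<subseteq> V" by (auto simp: A_def)
      have c: "(x, x') \<in> E \<longleftrightarrow> ((if x \<in> A then f z else f x), (if x' \<in> A then f z else f x')) \<in> D"
        if "z \<in> A" "x \<in> V" "x' \<in> V" for z x x'
        using hom_constant_on_independent[OF f(1)[unfolded H_def] AV ind that] .
      have "(x, x') \<in> E \<longleftrightarrow> (\<theta> x, \<theta> x') \<in> D" if "x \<in> V" "x' \<in> V" for x x'
        using c[OF u(1) that] off[OF fB] that u by (auto simp: A_def)
      moreover have "(x, x') \<in> E \<longleftrightarrow> (g (\<theta> x), g (\<theta> x')) \<in> D" if "x \<in> V" "x' \<in> V" for x x'
        using c[OF u(3) that] off[OF fB] that u by (auto simp: A_def g_def)
      ultimately show ?thesis using \<theta> by (simp add: Ha_def Hb_def T_def strong_homs_def D1_def)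
    qed
    show ?thesis
    proof (cases "\<theta> \<in> Ha \<and> \<theta> \<in> Hb")
      case True
      have "sum w {f \<in> H. merge f = \<theta>} \<le> sum w (PiE V B)"
        using box w_nonneg finite_V by (intro sum_mono2 finite_PiE) (auto simp: B_def)
      then show ?thesis using True total by (simp add: algebra_simps)
    next
      case False
      define \<theta>' where "\<theta>' = restrict (g \<circ> \<theta>) V"
      have const: "f = \<theta> \<and> \<theta> \<in> Ha \<and> A \<noteq> {} \<or> f = \<theta>' \<and> \<theta> \<in> Hb \<and> A \<noteq> {}"
        if f: "f \<in> H" "merge f = \<theta>" for f
      proof -
        have fB: "f \<in> PiE V B" using box f by blast
        have ext: "f \<in> extensional V" "\<theta> \<in> extensional V"
          using fB \<theta> by (auto simp: T_def PiE_def)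
        have E: "(x, x') \<in> E \<longleftrightarrow> (f x, f x') \<in> D" if "x \<in> V" "x' \<in> V" for x x'
          using f(1) that by (simp add: H_def strong_homs_def)
        have "(\<forall>v\<in>A. f v = a) \<or> (\<forall>v\<in>A. f v = b)"
          using mixed[OF f] on[OF fB] False by blast
        then show ?thesis
        proof
          assume all: "\<forall>v\<in>A. f v = a"
          have eq: "f v = \<theta> v" if "v \<in> V" for v
            using all off[OF fB that] that by (cases "v \<in> A") (auto simp: A_def)
          have "f = \<theta>" using ext eq by (rule extensionalityI)
          moreover have "\<theta> \<in> Ha"
            using \<theta> E eq by (simp add: Ha_def T_def strong_homs_def)
          moreover have "A \<noteq> {}"
          proof
            assume "A = {}"
            then have "g (\<theta> v) = \<theta> v" if "v \<in> V" for v using that by (auto simp: A_def g_def)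
            then have "\<theta> \<in> Hb" using \<open>\<theta> \<in> Ha\<close> by (simp add: Ha_def Hb_def strong_homs_def D1_def)
            then show False using \<open>\<theta> \<in> Ha\<close> False by blast
          qed
          ultimately show ?thesis by blast
        next
          assume all: "\<forall>v\<in>A. f v = b"
          have eq: "f v = g (\<theta> v)" if "v \<in> V" for v
            using all off[OF fB that] that by (cases "v \<in> A") (auto simp: A_def g_def)
          have "f = \<theta>'" unfolding \<theta>'_def using ext eq by (intro extensionalityI[of _ V]) auto
          moreover have "\<theta> \<in> Hb"
            using \<theta> E eq by (simp add: Hb_def T_def strong_homs_def D1_def)
          moreover have "A \<noteq> {}"
          proof
            assume "A = {}"
            then have "g (\<theta> v) = \<theta> v" if "v \<in> V" for v using that by (auto simp: A_def g_def)
            then have "\<theta> \<in> Ha" using \<open>\<theta> \<in> Hb\<close> by (simp add: Ha_def Hb_def strong_homs_def D1_def)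
            then show False using \<open>\<theta> \<in> Hb\<close> False by blast
          qed
          ultimately show ?thesis by blast
        qed
      qed
      have finA: "finite A" using finite_V by (simp add: A_def)
      have power: "(\<Prod>v\<in>V. if v \<in> A then q else 1) \<le> q" if "A \<noteq> {}" "0 \<le> q" "q \<le> 1" for q :: real
      proof -
        have "(\<Prod>v\<in>V. if v \<in> A then q else 1) = q ^ card A"
          using finite_V by (simp add: prod.If_cases A_def Int_def)
        also have "\<dots> \<le> q ^ 1"
          using that finA by (intro power_decreasing) (auto simp: Suc_le_eq card_gt_0_iff)
        finally show ?thesis by simp
      qed
      have "w \<theta> = (\<Prod>v\<in>V. if v \<in> A then p else 1) * wS \<theta>"
        unfolding w_def wS_def prod.distrib[symmetric]
        using y by (intro prod.cong) (auto simp: A_def)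
      then have wa: "w \<theta> \<le> p * wS \<theta>" if "A \<noteq> {}"
        using power[OF that] p wS_nonneg[OF \<theta>] by (simp add: mult_right_mono)
      have "w \<theta>' = (\<Prod>v\<in>V. if v \<in> A then 1 - p else 1) * wS \<theta>"
        unfolding w_def wS_def prod.distrib[symmetric] \<theta>'_def
        using y \<theta>b by (intro prod.cong) (auto simp: A_def g_def)
      then have wb: "w \<theta>' \<le> (1 - p) * wS \<theta>" if "A \<noteq> {}"
        using power[OF that] p wS_nonneg[OF \<theta>] by (simp add: mult_right_mono)
      show ?thesis
      proof (cases "{f \<in> H. merge f = \<theta>} = {}")
        case True
        show ?thesis unfolding True using p wS_nonneg[OF \<theta>] by simp
      next
        case nonempty: False
        then have "A \<noteq> {}" using const by blast
        have "\<theta> \<in> Ha \<or> \<theta> \<in> Hb" using const nonempty by blast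
        then show ?thesis
        proof
          assume "\<theta> \<in> Ha"
          then have "f = \<theta>" if "f \<in> H" "merge f = \<theta>" for f
            using const[OF that] False \<open>\<theta> \<in> Ha\<close> by metis
          then have "{f \<in> H. merge f = \<theta>} \<subseteq> {\<theta>}" by auto
          with nonempty have "{f \<in> H. merge f = \<theta>} = {\<theta>}" by auto
          then show ?thesis using wa \<open>A \<noteq> {}\<close> \<open>\<theta> \<in> Ha\<close> False by simp
        next
          assume "\<theta> \<in> Hb"
          then have "f = \<theta>'" if "f \<in> H" "merge f = \<theta>" for f
            using const[OF that] False \<open>\<theta> \<in> Hb\<close> by metis
          then have "{f \<in> H. merge f = \<theta>} \<subseteq> {\<theta>'}" by auto
          with nonempty have "{f \<in> H. merge f = \<theta>} = {\<theta>'}" by auto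
          then show ?thesis using wb \<open>A \<noteq> {}\<close> \<open>\<theta> \<in> Hb\<close> False by simp
        qed
      qed
    qed
  qed
  have "hom_density V E W D y = sum w H" unfolding hom_density_def H_def w_def ..
  also have "\<dots> = (\<Sum>\<theta>\<in>T. sum w {f \<in> H. merge f = \<theta>})"
    using finH finT W
    by (intro sum.group[symmetric]) (auto simp: H_def T_def merge_def strong_homs_def split: if_splits)
  also have "\<dots> \<le> (\<Sum>\<theta>\<in>T. p * (if \<theta> \<in> Ha then wS \<theta> else 0) + (1 - p) * (if \<theta> \<in> Hb then wS \<theta> else 0))"
    by (intro sum_mono fibre)
  also have "\<dots> = p * (\<Sum>\<theta>\<in>T. if \<theta> \<in> Ha then wS \<theta> else 0) + (1 - p) * (\<Sum>\<theta>\<in>T. if \<theta> \<in> Hb then wS \<theta> else 0)"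
    by (simp only: sum.distrib sum_distrib_left)
  also have "\<dots> = p * sum wS Ha + (1 - p) * sum wS Hb"
    using finT sub by (simp flip: sum.inter_restrict add: Int_absorb1)
  finally show ?thesis unfolding dens_a dens_b .
qed

text \<open>
  Symmetrising repeatedly removes one of two non-adjacent colours each time, so it ends with weights
  on a clique.
\<close>

lemma hom_density_le_clique:
  assumes "finite W" "y \<in> prob_weights W"
    and "\<And>c d. c \<in> W \<Longrightarrow> d \<in> W \<Longrightarrow> (c, d) \<in> D \<Longrightarrow> (d, c) \<in> D"
    and "\<And>c. c \<in> W \<Longrightarrow> (c, c) \<notin> D"
  shows "\<exists>K z. K \<subseteq> W \<and> (\<forall>a\<in>K. \<forall>b\<in>K. a \<noteq> b \<longrightarrow> (a, b) \<in> D) \<and> z \<in> prob_weights K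
    \<and> hom_density V E W D y \<le> hom_density V E K (- Id) z"
  using assms
proof (induction W arbitrary: y rule: finite_psubset_induct)
  case (psubset W)
  show ?case
  proof (cases "\<forall>a\<in>W. \<forall>b\<in>W. a \<noteq> b \<longrightarrow> (a, b) \<in> D")
    case True
    have "hom_density V E W D y = hom_density V E W (- Id) (y \<circ> id)"
      using True psubset.prems(3) by (intro hom_density_relabel) auto
    then show ?thesis using True psubset.prems(1) by (intro exI[of _ W] exI[of _ y]) simp
  next
    case False
    then obtain a b where ab: "a \<in> W" "b \<in> W" "a \<noteq> b" "(a, b) \<notin> D" by blast
    define S where "S = y a + y b"
    have y0: "0 \<le> y c" if "c \<in> W" for c using psubset.prems that by (simp add: prob_weights_def)
    have "0 \<le> y a" "0 \<le> y b" "0 \<le> S" using y0 ab by (auto simp: S_def)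
    \<comment> \<open>For \<open>S = 0\<close> both weights vanish and any \<open>p\<close> between \<open>0\<close> and \<open>1\<close> would do.\<close>
    define p where "p = (if S = 0 then 0 else y a / S)"
    have p: "0 \<le> p" "p \<le> 1" "y a = p * S" "y b = (1 - p) * S"
    proof -
      show "0 \<le> p" using \<open>0 \<le> y a\<close> \<open>0 \<le> S\<close> by (simp add: p_def)
      show "p \<le> 1" using \<open>0 \<le> y b\<close> \<open>0 \<le> S\<close> by (simp add: p_def S_def divide_le_eq)
      show eq: "y a = p * S" using \<open>0 \<le> y a\<close> \<open>0 \<le> y b\<close> by (auto simp: p_def S_def)
      have "y b = S - y a" by (simp add: S_def)
      then show "y b = (1 - p) * S" using eq by (simp add: left_diff_distrib)
    qed
    have step: "y(c := S) \<in> prob_weights (W - {d})" if "c \<in> W" "d \<in> W" "c \<noteq> d" "S = y c + y d" for c d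
    proof -
      have "sum y W = y c + y d + sum y (W - {d} - {c})"
        using that psubset.hyps by (simp add: sum.remove[of W d] sum.remove[of "W - {d}" c])
      moreover have "sum (y(c := S)) (W - {d}) = S + sum y (W - {d} - {c})"
        using that psubset.hyps by (simp add: sum.remove[of "W - {d}" c])
      ultimately show ?thesis using psubset.prems(1) y0 that \<open>0 \<le> S\<close> by (auto simp: prob_weights_def)
    qed
    let ?a = "hom_density V E (W - {b}) D (y(a := S))"
    let ?b = "hom_density V E (W - {a}) D (y(b := S))"
    have "hom_density V E W D y \<le> p * ?a + (1 - p) * ?b"
      by (rule hom_density_shift_weight[OF psubset.hyps ab(1,2,3) psubset.prems(2,3) ab(4) y0 p(3,4,1,2) \<open>0 \<le> S\<close>])
    also have "\<dots> \<le> max ?a ?b"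
      using p by (intro convex_bound_le) auto
    finally have le: "hom_density V E W D y \<le> ?a \<or> hom_density V E W D y \<le> ?b" by linarith
    have Wa: "W - {a} \<subset> W" and Wb: "W - {b} \<subset> W" using ab by auto
    show ?thesis
      using le
    proof
      assume *: "hom_density V E W D y \<le> ?a"
      have "\<exists>K z. K \<subseteq> W - {b} \<and> (\<forall>c\<in>K. \<forall>d\<in>K. c \<noteq> d \<longrightarrow> (c, d) \<in> D) \<and> z \<in> prob_weights K
        \<and> ?a \<le> hom_density V E K (- Id) z"
      proof (rule psubset.IH[OF Wb])
        show "y(a := S) \<in> prob_weights (W - {b})" using ab by (intro step) (auto simp: S_def)
      qed (use psubset.prems(2,3) in auto)
      then obtain K z where "K \<subseteq> W - {b}" "\<forall>c\<in>K. \<forall>d\<in>K. c \<noteq> d \<longrightarrow> (c, d) \<in> D"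
        "z \<in> prob_weights K" "?a \<le> hom_density V E K (- Id) z" by blast
      then show ?thesis using * by (intro exI[of _ K] exI[of _ z]) auto
    next
      assume *: "hom_density V E W D y \<le> ?b"
      have "\<exists>K z. K \<subseteq> W - {a} \<and> (\<forall>c\<in>K. \<forall>d\<in>K. c \<noteq> d \<longrightarrow> (c, d) \<in> D) \<and> z \<in> prob_weights K
        \<and> ?b \<le> hom_density V E K (- Id) z"
      proof (rule psubset.IH[OF Wa])
        show "y(b := S) \<in> prob_weights (W - {a})" using ab by (intro step) (auto simp: S_def)
      qed (use psubset.prems(2,3) in auto)
      then obtain K z where "K \<subseteq> W - {a}" "\<forall>c\<in>K. \<forall>d\<in>K. c \<noteq> d \<longrightarrow> (c, d) \<in> D"
        "z \<in> prob_weights K" "?b \<le> hom_density V E K (- Id) z" by blast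
      then show ?thesis using * by (intro exI[of _ K] exI[of _ z]) auto
    qed
  qed
qed

end

section \<open>Embeddings, induced copies and cliques\<close>

definition embeddings :: "'a set \<Rightarrow> 'a rel \<Rightarrow> 'b set \<Rightarrow> 'b rel \<Rightarrow> ('a \<Rightarrow> 'b) set" where
  "embeddings V E W D = {f \<in> strong_homs V E W D. inj_on f V}"

lemma finite_embeddings [simp]:
  assumes "finite V" "finite W"
  shows "finite (embeddings V E W D)"
  using assms by (simp add: embeddings_def)

lemma card_automorphisms_pos:
  assumes "finite V"
  shows "0 < card (embeddings V E V E)"
proof -
  have "restrict id V \<in> embeddings V E V E" by (auto simp: embeddings_def strong_homs_def)
  then show ?thesis using assms finite_embeddings[of V V E E] card_gt_0_iff by blast
qed

text \<open>
  Fixing one embedding \<open>g\<close> with image \<open>S\<close>, every other one is \<open>g\<close> after an automorphism.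
\<close>

lemma card_embeddings_onto:
  assumes V: "finite V" and g: "g \<in> embeddings V E W D" "g ` V = S"
  shows "card {f \<in> embeddings V E W D. f ` V = S} = card (embeddings V E V E)"
proof -
  let ?i = "inv_into V g"
  have inj: "inj_on g V" and gE: "\<And>u v. u \<in> V \<Longrightarrow> v \<in> V \<Longrightarrow> (u, v) \<in> E \<longleftrightarrow> (g u, g v) \<in> D"
    and SW: "S \<subseteq> W"
    using g by (auto simp: embeddings_def strong_homs_def)
  have i: "?i x \<in> V" "g (?i x) = x" if "x \<in> S" for x
    using that g(2) inv_into_into f_inv_into_f by metis+
  have i': "?i (g v) = v" if "v \<in> V" for v using inj that by simp
  have onto: "\<pi> ` V = V" if "\<pi> \<in> embeddings V E V E" for \<pi>
    using that V by (intro endo_inj_surj) (auto simp: embeddings_def strong_homs_def)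
  have "bij_betw (\<lambda>\<pi>. restrict (g \<circ> \<pi>) V) (embeddings V E V E) {f \<in> embeddings V E W D. f ` V = S}"
  proof (rule bij_betwI)
    show "(\<lambda>\<pi>. restrict (g \<circ> \<pi>) V) \<in> embeddings V E V E \<rightarrow> {f \<in> embeddings V E W D. f ` V = S}"
    proof
      fix \<pi> assume p: "\<pi> \<in> embeddings V E V E"
      then have pV: "\<pi> v \<in> V" if "v \<in> V" for v
        using that by (auto simp: embeddings_def strong_homs_def)
      have "restrict (g \<circ> \<pi>) V ` V = g ` \<pi> ` V" by force
      then have im: "restrict (g \<circ> \<pi>) V ` V = S" using onto[OF p] g(2) by simp
      have "inj_on (restrict (g \<circ> \<pi>) V) V"
        using p pV inj by (auto simp: inj_on_def embeddings_def)
      moreover have "restrict (g \<circ> \<pi>) V \<in> strong_homs V E W D"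
        using p pV gE SW g(2) by (auto simp: embeddings_def strong_homs_def)
      ultimately show "restrict (g \<circ> \<pi>) V \<in> {f \<in> embeddings V E W D. f ` V = S}"
        using im by (simp add: embeddings_def)
    qed
    show "(\<lambda>f. restrict (?i \<circ> f) V) \<in> {f \<in> embeddings V E W D. f ` V = S} \<rightarrow> embeddings V E V E"
    proof
      fix f assume f: "f \<in> {f \<in> embeddings V E W D. f ` V = S}"
      then have fS: "f v \<in> S" if "v \<in> V" for v using that by auto
      have "inj_on (restrict (?i \<circ> f) V) V"
      proof (rule inj_onI)
        fix u v assume uv: "u \<in> V" "v \<in> V" "restrict (?i \<circ> f) V u = restrict (?i \<circ> f) V v"
        then have "f u = f v" using i(2)[OF fS] by (metis comp_apply restrict_apply')
        then show "u = v" using f uv by (auto simp: embeddings_def inj_on_def)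
      qed
      moreover have "(u, v) \<in> E \<longleftrightarrow> (?i (f u), ?i (f v)) \<in> E" if "u \<in> V" "v \<in> V" for u v
        using f that gE[OF i(1)[OF fS] i(1)[OF fS], of u v] i(2)[OF fS]
        by (simp add: embeddings_def strong_homs_def)
      then have "restrict (?i \<circ> f) V \<in> strong_homs V E V E"
        using i(1)[OF fS] by (simp add: strong_homs_def)
      ultimately show "restrict (?i \<circ> f) V \<in> embeddings V E V E" by (simp add: embeddings_def)
    qed
    show "restrict (?i \<circ> restrict (g \<circ> \<pi>) V) V = \<pi>" if "\<pi> \<in> embeddings V E V E" for \<pi>
      using that i' by (intro extensionalityI[of _ V]) (auto simp: embeddings_def strong_homs_def PiE_def)
    show "restrict (g \<circ> restrict (?i \<circ> f) V) V = f" if "f \<in> {f \<in> embeddings V E W D. f ` V = S}" for f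
      using that i by (intro extensionalityI[of _ V]) (auto simp: embeddings_def strong_homs_def PiE_def)
  qed
  then show ?thesis by (rule bij_betw_same_card[symmetric])
qed

lemma card_embeddings:
  assumes "finite V" "finite W"
  shows "card (embeddings V E W D)
    = card (embeddings V E V E) * card {S. \<exists>f\<in>embeddings V E W D. f ` V = S}"
proof -
  let ?M = "embeddings V E W D" and ?I = "{S. \<exists>f\<in>embeddings V E W D. f ` V = S}"
  have I: "?I = (\<lambda>f. f ` V) ` ?M" by auto
  have fin: "finite ?M" using assms by simp
  have "card ?M = (\<Sum>f\<in>?M. 1)" by simp
  also have "\<dots> = (\<Sum>S\<in>?I. \<Sum>f\<in>{f \<in> ?M. f ` V = S}. 1)"
    using fin unfolding I by (intro sum.group[symmetric]) auto
  also have "\<dots> = (\<Sum>S\<in>?I. card (embeddings V E V E))"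
  proof (rule sum.cong)
    fix S assume "S \<in> ?I"
    then obtain g where "g \<in> ?M" "g ` V = S" by blast
    from card_embeddings_onto[OF assms(1) this]
    show "(\<Sum>f\<in>{f \<in> ?M. f ` V = S}. 1) = card (embeddings V E V E)" by simp
  qed simp
  finally show ?thesis by simp
qed

lemma digraph_iso_induced_iff:
  assumes F: "pair_graph F" and S: "S \<subseteq> pverts G"
  shows "digraph_iso (with_proj F) (with_proj G \<restriction> S)
    \<longleftrightarrow> (\<exists>f\<in>embeddings (pverts F) (parcs F) (pverts G) (parcs G). f ` pverts F = S)"
    (is "?L \<longleftrightarrow> ?R")
proof -
  interpret F: pair_graph F by (rule F)
  let ?V = "pverts F" and ?E = "parcs F"
  have EV: "u \<in> ?V" "v \<in> ?V" if "(u, v) \<in> ?E" for u v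
    using that F.wellformed' by auto
  show ?thesis
  proof
    assume ?L
    then obtain h where h: "pre_digraph.digraph_isomorphism (with_proj F) h"
      and eq: "with_proj G \<restriction> S = app_iso h (with_proj F)"
      by (auto simp: digraph_iso_def)
    have inj: "inj_on (iso_verts h) ?V"
      and ends: "\<And>a. a \<in> ?E \<Longrightarrow> iso_verts h (fst a) = iso_tail h (iso_arcs h a)
        \<and> iso_verts h (snd a) = iso_head h (iso_arcs h a)"
      using h by (auto simp: pre_digraph.digraph_isomorphism_def)
    have VS: "S = iso_verts h ` ?V"
      and arcs: "{e \<in> parcs G. fst e \<in> S \<and> snd e \<in> S} = iso_arcs h ` ?E"
      and "fst = iso_tail h" "snd = iso_head h"
      using arg_cong[OF eq, of verts] arg_cong[OF eq, of arcs]
        arg_cong[OF eq, of tail] arg_cong[OF eq, of head]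
      by (simp_all add: induce_subgraph_def)
    then have pair: "iso_arcs h (u, v) = (iso_verts h u, iso_verts h v)" if "(u, v) \<in> ?E" for u v
      using ends[OF that] by (metis fst_conv snd_conv prod.collapse)
    have iff: "(u, v) \<in> ?E \<longleftrightarrow> (iso_verts h u, iso_verts h v) \<in> parcs G" if "u \<in> ?V" "v \<in> ?V" for u v
    proof
      assume "(u, v) \<in> ?E"
      then have "iso_arcs h (u, v) \<in> {e \<in> parcs G. fst e \<in> S \<and> snd e \<in> S}" using arcs by blast
      then show "(iso_verts h u, iso_verts h v) \<in> parcs G" using pair[OF \<open>(u, v) \<in> ?E\<close>] by simp
    next
      assume "(iso_verts h u, iso_verts h v) \<in> parcs G"
      then have "(iso_verts h u, iso_verts h v) \<in> iso_arcs h ` ?E"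
        using that VS unfolding arcs[symmetric] by simp
      then obtain u' v' where a: "(u', v') \<in> ?E"
        and *: "iso_arcs h (u', v') = (iso_verts h u, iso_verts h v)" by auto
      have "iso_verts h u' = iso_verts h u" "iso_verts h v' = iso_verts h v"
        using * pair[OF a] by auto
      then have "u' = u" "v' = v" using inj EV[OF a] that by (auto dest: inj_onD)
      then show "(u, v) \<in> ?E" using a by simp
    qed
    let ?f = "restrict (iso_verts h) ?V"
    have "?f \<in> embeddings ?V ?E (pverts G) (parcs G)"
      using iff inj VS S by (auto simp: embeddings_def strong_homs_def inj_on_def)
    moreover have "?f ` ?V = S" using VS by simp
    ultimately show ?R by blast
  next
    assume ?R
    then obtain f where f: "f \<in> embeddings ?V ?E (pverts G) (parcs G)" and im: "f ` ?V = S" by blast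
    have inj: "inj_on f ?V"
      and iff: "\<And>u v. u \<in> ?V \<Longrightarrow> v \<in> ?V \<Longrightarrow> (u, v) \<in> ?E \<longleftrightarrow> (f u, f v) \<in> parcs G"
      using f by (auto simp: embeddings_def strong_homs_def)
    define h where
      "h = \<lparr>iso_verts = f, iso_arcs = map_prod f f, iso_head = snd, iso_tail = fst\<rparr>"
    have "inj_on (map_prod f f) ?E"
      using inj EV by (auto simp: inj_on_def)
    then have "pre_digraph.digraph_isomorphism (with_proj F) h"
      using inj F.wf_digraph_axioms by (auto simp: pre_digraph.digraph_isomorphism_def h_def)
    moreover have "with_proj G \<restriction> S = app_iso h (with_proj F)"
    proof -
      have "{e \<in> parcs G. fst e \<in> S \<and> snd e \<in> S} = map_prod f f ` ?E"
      proof (intro set_eqI iffI)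
        fix e assume "e \<in> {e \<in> parcs G. fst e \<in> S \<and> snd e \<in> S}"
        then have e: "e \<in> parcs G" "fst e \<in> f ` ?V" "snd e \<in> f ` ?V" using im by auto
        then obtain u v where "u \<in> ?V" "v \<in> ?V" "e = (f u, f v)"
          by (metis imageE prod.collapse)
        then show "e \<in> map_prod f f ` ?E" using e(1) iff[of u v] by (intro image_eqI[of _ _ "(u, v)"]) auto
      next
        fix e assume "e \<in> map_prod f f ` ?E"
        then obtain u v where "(u, v) \<in> ?E" "e = (f u, f v)" by auto
        then show "e \<in> {e \<in> parcs G. fst e \<in> S \<and> snd e \<in> S}" using iff EV[of u v] im by auto
      qed
      then show ?thesis using im by (simp add: induce_subgraph_def app_iso_def h_def)
    qed
    ultimately show ?L unfolding digraph_iso_def by blast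
  qed
qed

lemma card_embeddings_induced_copies:
  assumes F: "pair_graph F" and "finite (pverts G)"
  shows "card (embeddings (pverts F) (parcs F) (pverts G) (parcs G))
    = card (embeddings (pverts F) (parcs F) (pverts F) (parcs F)) * induced_copies F G"
proof -
  have fin: "finite (pverts F)" using F by (rule pair_fin_digraph.pair_finite_verts[OF pair_digraph.axioms(1)[OF pair_graph.axioms(1)]])
  let ?M = "embeddings (pverts F) (parcs F) (pverts G) (parcs G)"
  have "{S. S \<subseteq> pverts G \<and> card S = card (pverts F) \<and> digraph_iso (with_proj F) (with_proj G \<restriction> S)}
    = {S. \<exists>f\<in>?M. f ` pverts F = S}"
  proof (intro Collect_cong iffI)
    fix S assume "\<exists>f\<in>?M. f ` pverts F = S"
    moreover from this have "S \<subseteq> pverts G" "card S = card (pverts F)"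
      by (auto simp: embeddings_def strong_homs_def card_image)
    ultimately show "S \<subseteq> pverts G \<and> card S = card (pverts F)
        \<and> digraph_iso (with_proj F) (with_proj G \<restriction> S)"
      using digraph_iso_induced_iff[OF F, of S G] by blast
  qed (use digraph_iso_induced_iff[OF F, of _ G] in blast)
  then show ?thesis
    using card_embeddings[OF fin assms(2)] by (simp add: induced_copies_def)
qed

lemma clique_free_card_less:
  assumes G: "pair_graph G" "clique_free k G"
    and K: "K \<subseteq> pverts G" "\<And>a b. a \<in> K \<Longrightarrow> b \<in> K \<Longrightarrow> a \<noteq> b \<Longrightarrow> (a, b) \<in> parcs G"
  shows "card K < k"
proof (rule ccontr)
  interpret G: pair_graph G by (rule G)
  assume "\<not> card K < k"
  then obtain K' where K': "K' \<subseteq> K" "card K' = k" "finite K'"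
    using obtain_subset_with_card_n[of k K] by (metis not_le_imp_less)
  define H where "H = \<lparr>pverts = K', parcs = {(u, v). u \<in> K' \<and> v \<in> K' \<and> u \<noteq> v}\<rparr>"
  have "complete_digraph k (with_proj H)"
    using K' by (auto simp: complete_digraph_pair_def H_def)
  moreover have "subgraph (with_proj H) (with_proj G)"
  proof -
    have "pair_wf_digraph H" by unfold_locales (auto simp: H_def)
    then show ?thesis
      using K K' G.wf_digraph_axioms by (auto simp: subgraph_def compatible_def wf_digraph_wp_iff H_def)
  qed
  ultimately show False using G(2) by (auto simp: clique_free_def)
qed

text \<open>
  The complete multipartite graph on \<open>n\<close> vertices whose parts are the colour classes of \<open>col\<close>.
\<close>

definition colour_graph :: "nat \<Rightarrow> (nat \<Rightarrow> 'c) \<Rightarrow> nat pair_pre_digraph" where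
  "colour_graph n col = \<lparr>pverts = {..<n}, parcs = {(i, j). i < n \<and> j < n \<and> col i \<noteq> col j}\<rparr>"

lemma pair_graph_colour_graph: "pair_graph (colour_graph n col)"
proof unfold_locales
  show "finite (parcs (colour_graph n col))"
    by (rule finite_subset[of _ "{..<n} \<times> {..<n}"]) (auto simp: colour_graph_def)
qed (auto simp: colour_graph_def symmetric_def sym_def)

lemma clique_free_colour_graph:
  assumes "col ` {..<n} \<subseteq> C" "finite C" "card C < k"
  shows "clique_free k (colour_graph n col)"
  unfolding clique_free_def
proof
  assume "\<exists>H. subgraph H (with_proj (colour_graph n col)) \<and> complete_digraph k H"
  then obtain H :: "(nat, nat \<times> nat) pre_digraph" where
    sub: "subgraph H (with_proj (colour_graph n col))" and K: "complete_digraph k H" by blast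
  have H: "verts H \<subseteq> {..<n}" using sub by (auto simp: subgraph_def colour_graph_def)
  have "col u \<noteq> col v" if "u \<in> verts H" "v \<in> verts H" "u \<noteq> v" for u v
  proof -
    have "(u, v) \<in> arcs_ends H" using K that by (auto simp: complete_digraph_def)
    then have "(u, v) \<in> parcs (colour_graph n col)" using arcs_ends_mono[OF sub] by auto
    then show ?thesis by (simp add: colour_graph_def)
  qed
  then have "inj_on col (verts H)" by (auto simp: inj_on_def)
  then have "card (verts H) \<le> card C"
    using H assms by (intro card_inj_on_le[of col]) auto
  then show False using K assms(3) by (simp add: complete_digraph_def)
qed

section \<open>Random colourings\<close>

text \<open>
  When the elements of \<open>U\<close> are coloured independently at random, the colours of the \<open>card V\<close>
  distinct elements hit by \<open>f\<close> are again independent with the same distribution.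
\<close>

lemma sum_weighted_colourings_through:
  assumes V: "finite V" and U: "finite U" and W: "finite W" and y: "y \<in> prob_weights W"
    and f: "f \<in> V \<rightarrow>\<^sub>E U" "inj_on f V"
  shows "(\<Sum>col\<in>{col \<in> U \<rightarrow>\<^sub>E W. restrict (col \<circ> f) V \<in> strong_homs V E W D}. \<Prod>j\<in>U. y (col j))
    = hom_density V E W D y"
proof -
  let ?C = "{col \<in> U \<rightarrow>\<^sub>E W. restrict (col \<circ> f) V \<in> strong_homs V E W D}"
  let ?i = "inv_into V f"
  have "(\<Sum>col\<in>?C. \<Prod>j\<in>U. y (col j))
    = (\<Sum>g\<in>strong_homs V E W D. \<Sum>col\<in>{col \<in> ?C. restrict (col \<circ> f) V = g}. \<Prod>j\<in>U. y (col j))"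
    using V U W by (intro sum.group[symmetric]) (auto intro: finite_subset[OF _ finite_PiE[of U "\<lambda>_. W"]])
  also have "\<dots> = (\<Sum>g\<in>strong_homs V E W D. \<Prod>v\<in>V. y (g v))"
  proof (rule sum.cong)
    fix g assume g: "g \<in> strong_homs V E W D"
    define B where "B j = (if j \<in> f ` V then {g (?i j)} else W)" for j
    have gW: "g v \<in> W" if "v \<in> V" for v using g that by (auto simp: strong_homs_def)
    have gext: "g \<in> extensional V" using g by (auto simp: strong_homs_def PiE_def)
    have fU: "f v \<in> U" if "v \<in> V" for v using f that by auto
    have "{col \<in> ?C. restrict (col \<circ> f) V = g} = PiE U B"
    proof (intro set_eqI iffI)
      fix col assume "col \<in> {col \<in> ?C. restrict (col \<circ> f) V = g}"
      then have col: "col \<in> U \<rightarrow>\<^sub>E W" and eq: "\<And>v. v \<in> V \<Longrightarrow> col (f v) = g v" by auto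
      then show "col \<in> PiE U B" using f(2) by (auto simp: B_def PiE_iff)
    next
      fix col assume col: "col \<in> PiE U B"
      have eq: "col (f v) = g v" if "v \<in> V" for v
        using PiE_mem[OF col fU[OF that]] that f(2) by (simp add: B_def)
      have "col j \<in> W" if "j \<in> U" for j
        using PiE_mem[OF col that] gW f(2) by (auto simp: B_def split: if_splits)
      then have "col \<in> U \<rightarrow>\<^sub>E W" using col by (auto simp: PiE_iff)
      moreover have "restrict (col \<circ> f) V = g"
        using eq gext by (intro extensionalityI[of _ V]) auto
      ultimately show "col \<in> {col \<in> ?C. restrict (col \<circ> f) V = g}" using g by simp
    qed
    then have "(\<Sum>col\<in>{col \<in> ?C. restrict (col \<circ> f) V = g}. \<Prod>j\<in>U. y (col j))
      = (\<Prod>j\<in>U. sum y (B j))"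
      using U W by (simp only:) (rule sum_prod_box; simp add: B_def)
    also have "\<dots> = (\<Prod>j\<in>f ` V. sum y (B j))"
      using U fU y by (intro prod.mono_neutral_right) (auto simp: B_def prob_weights_def)
    also have "\<dots> = (\<Prod>v\<in>V. sum y (B (f v)))" using f(2) by (simp add: prod.reindex)
    also have "\<dots> = (\<Prod>v\<in>V. y (g v))" using f(2) by (intro prod.cong) (auto simp: B_def)
    finally show "(\<Sum>col\<in>{col \<in> ?C. restrict (col \<circ> f) V = g}. \<Prod>j\<in>U. y (col j)) = (\<Prod>v\<in>V. y (g v))" .
  qed simp
  finally show ?thesis by (simp add: hom_density_def)
qed

text \<open>
  First moment argument: in expectation over the random colouring of \<open>U\<close>, each injection of \<open>V\<close>
  becomes a strong homomorphism with probability \<open>hom_density V E W D y\<close>, so some colouring does at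
  least as well as the average.
\<close>

lemma exists_good_colouring:
  assumes V: "finite V" and U: "finite U" and W: "finite W" and y: "y \<in> prob_weights W"
  shows "\<exists>col \<in> U \<rightarrow>\<^sub>E W. real (card {f \<in> V \<rightarrow>\<^sub>E U. inj_on f V}) * hom_density V E W D y
    \<le> real (card {f \<in> V \<rightarrow>\<^sub>E U. inj_on f V \<and> restrict (col \<circ> f) V \<in> strong_homs V E W D})"
proof (rule ccontr)
  let ?I = "{f \<in> V \<rightarrow>\<^sub>E U. inj_on f V}" and ?C = "U \<rightarrow>\<^sub>E W"
  let ?w = "\<lambda>col. \<Prod>j\<in>U. y (col j)"
  let ?good = "\<lambda>col f. restrict (col \<circ> f) V \<in> strong_homs V E W D"
  let ?c = "real (card ?I) * hom_density V E W D y"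
  define N where "N col = real (card {f \<in> ?I. ?good col f})" for col
  assume "\<not> ?thesis"
  then have less: "N col < ?c" if "col \<in> ?C" for col using that by (auto simp: N_def conj_assoc)
  have finI: "finite ?I" using finite_PiE[of V "\<lambda>_. U"] V U by simp
  have finC: "finite ?C" using U W by (simp add: finite_PiE)
  have N: "N col = (\<Sum>f\<in>?I. if ?good col f then 1 else 0)" for col
    using finI by (simp add: N_def sum.If_cases Int_def)
  have "(\<Sum>col\<in>?C. ?w col * N col) = (\<Sum>col\<in>?C. \<Sum>f\<in>?I. if ?good col f then ?w col else 0)"
    unfolding N sum_distrib_left by (intro sum.cong) auto
  also have "\<dots> = (\<Sum>f\<in>?I. \<Sum>col\<in>?C. if ?good col f then ?w col else 0)" by (rule sum.swap)
  also have "\<dots> = (\<Sum>f\<in>?I. hom_density V E W D y)"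
  proof (rule sum.cong)
    fix f assume f: "f \<in> ?I"
    have "(\<Sum>col\<in>?C. if ?good col f then ?w col else 0) = sum ?w {col \<in> ?C. ?good col f}"
      using finC by (simp add: sum.inter_filter)
    also have "\<dots> = hom_density V E W D y"
      using f by (intro sum_weighted_colourings_through V U W y) auto
    finally show "(\<Sum>col\<in>?C. if ?good col f then ?w col else 0) = hom_density V E W D y" .
  qed simp
  finally have avg: "(\<Sum>col\<in>?C. ?w col * N col) = ?c" by simp
  have w1: "sum ?w ?C = 1" using U W y by (rule sum_prod_all_maps)
  have w0: "0 \<le> ?w col" if "col \<in> ?C" for col using prod_weights_nonneg[OF y that] .
  have "(\<Sum>col\<in>?C. ?w col * (?c - N col)) = sum ?w ?C * ?c - (\<Sum>col\<in>?C. ?w col * N col)"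
    by (simp only: right_diff_distrib sum_subtractf sum_distrib_right)
  also have "\<dots> = 0" using w1 avg by simp
  finally have "\<forall>col\<in>?C. ?w col * (?c - N col) = 0"
    using finC w0 less by (subst (asm) sum_nonneg_eq_0_iff) (auto simp: less_imp_le)
  then have "\<forall>col\<in>?C. ?w col = 0" using less by fastforce
  then have "sum ?w ?C = 0" by simp
  then show False using w1 by simp
qed

lemma card_injections:
  assumes "finite V" "card V \<le> n"
  shows "real (card {f \<in> V \<rightarrow>\<^sub>E {..<n}. inj_on f V}) = fact (card V) * real (n choose card V)"
proof -
  have "card {f \<in> V \<rightarrow>\<^sub>E {..<n}. inj_on f V} = (\<Prod>i = 0..<card V. n - i)"
    using card_inj_on_subset_funcset[of V "{..<n}" V] assms(1) by simp
  moreover have "real (n choose card V) = (\<Prod>i = 0..<card V. real (n - i)) / fact (card V)"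
    using assms(2) by (simp add: binomial_altdef_of_nat prod_dividef fact_prod_rev)
  ultimately show ?thesis by simp
qed

lemma power_over_choose_tendsto: "(\<lambda>n. real n ^ s / real (n choose s)) \<longlonglongrightarrow> fact s"
proof -
  have factor: "(\<lambda>n. real (n - i) / real n) \<longlonglongrightarrow> 1" for i
  proof -
    have "(\<lambda>n. 1 - real i / real n) \<longlonglongrightarrow> 1 - 0"
      by (intro tendsto_intros lim_const_over_n)
    moreover have "eventually (\<lambda>n. 1 - real i / real n = real (n - i) / real n) sequentially"
      using eventually_gt_at_top[of i] by eventually_elim (simp add: field_simps of_nat_diff)
    ultimately show ?thesis by (simp add: tendsto_cong)
  qed
  have "(\<lambda>n. fact s / (\<Prod>i = 0..<s. real (n - i) / real n)) \<longlonglongrightarrow> fact s / (\<Prod>i = 0..<s. 1)"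
    by (intro tendsto_intros tendsto_prod factor) simp
  moreover have "eventually (\<lambda>n. fact s / (\<Prod>i = 0..<s. real (n - i) / real n)
      = real n ^ s / real (n choose s)) sequentially"
    using eventually_gt_at_top[of s]
  proof eventually_elim
    case (elim n)
    then have "real (n choose s) = (\<Prod>i = 0..<s. real (n - i)) / fact s"
      by (simp add: binomial_altdef_of_nat prod_dividef fact_prod_rev)
    then show ?case by (simp add: prod_dividef)
  qed
  ultimately show ?thesis by (simp add: tendsto_cong)
qed

section \<open>A formula for the inducibility\<close>

text \<open>
  Write \<open>M\<close> for the maximal density on \<open>k - 1\<close> colours. For the upper bound, the embeddings into a
  \<open>K\<^sub>k\<close>-free graph on \<open>n\<close> vertices are among its strong homomorphisms, which number \<open>n ^ s\<close> times a
  density with uniform weights, hence at most \<open>n ^ s * M\<close> by symmetrisation to a clique of fewer than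
  \<open>k\<close> vertices. For the lower bound, a random colouring with \<open>k - 1\<close> colours gives a \<open>K\<^sub>k\<close>-free
  complete multipartite graph whose expected density is, for every \<open>n \<ge> s\<close>, exactly the constant
  factor times the density of the chosen weights. The two bounds squeeze the sequence, which in
  particular shows that the limit exists.
\<close>

theorem inducibility_eq_max_hom_density:
  fixes F :: "'a pair_pre_digraph"
  assumes F: "pair_graph F" and mp: "complete_multipartite (pverts F) (parcs F)" and k: "2 \<le> k"
  shows "inducibility k F = fact (card (pverts F))
      / real (card (embeddings (pverts F) (parcs F) (pverts F) (parcs F)))
      * max_hom_density (pverts F) (parcs F) (k - 1)"
proof -
  interpret F: complete_multipartite "pverts F" "parcs F" by (rule mp)
  let ?V = "pverts F" and ?E = "parcs F"
  let ?s = "card ?V" and ?A = "real (card (embeddings ?V ?E ?V ?E))"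
  let ?M = "max_hom_density ?V ?E (k - 1)"
  define densities where "densities n = {induced_density F G | G :: nat pair_pre_digraph.
      pair_graph G \<and> card (pverts G) = n \<and> clique_free k G}" for n
  have A: "?A > 0" using card_automorphisms_pos[OF F.finite_V] by simp
  have finite: "finite (densities n)" for n
  proof (rule finite_subset)
    show "densities n \<subseteq> (\<lambda>j. real j / real (n choose ?s)) ` {..2 ^ n}"
    proof
      fix d assume "d \<in> densities n"
      then obtain G :: "nat pair_pre_digraph" where G: "pair_graph G" "card (pverts G) = n"
        and d: "d = induced_density F G" by (auto simp: densities_def)
      interpret G: pair_graph G by (rule G)
      have "induced_copies F G \<le> card (Pow (pverts G))"
        unfolding induced_copies_def using G.pair_finite_verts by (intro card_mono) auto
      then show "d \<in> (\<lambda>j. real j / real (n choose ?s)) ` {..2 ^ n}"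
        using G(2) G.pair_finite_verts by (auto simp: d induced_density_def card_Pow)
    qed
  qed simp
  have copies: "?A * real (induced_copies F G) = real (card (embeddings ?V ?E (pverts G) (parcs G)))"
    if "finite (pverts G)" for G :: "nat pair_pre_digraph"
    using card_embeddings_induced_copies[OF F that] by simp
  have lower: "\<exists>d\<in>densities n. fact ?s / ?A * hom_density ?V ?E {..<k - 1} (- Id) y \<le> d"
    if n: "?s \<le> n" and y: "y \<in> prob_weights {..<k - 1}" for n y
  proof -
    obtain col where col: "col \<in> {..<n} \<rightarrow>\<^sub>E {..<k - 1}"
      and le: "real (card {f \<in> ?V \<rightarrow>\<^sub>E {..<n}. inj_on f ?V}) * hom_density ?V ?E {..<k - 1} (- Id) y
        \<le> real (card {f \<in> ?V \<rightarrow>\<^sub>E {..<n}. inj_on f ?V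
            \<and> restrict (col \<circ> f) ?V \<in> strong_homs ?V ?E {..<k - 1} (- Id)})"
      using exists_good_colouring[OF F.finite_V finite_lessThan finite_lessThan y] by blast
    define G where "G = colour_graph n col"
    have verts: "pverts G = {..<n}" by (simp add: G_def colour_graph_def)
    have "clique_free k G"
      unfolding G_def using col k by (intro clique_free_colour_graph[of _ _ "{..<k - 1}"]) auto
    then have dens: "induced_density F G \<in> densities n"
      unfolding densities_def using pair_graph_colour_graph[of n col] verts
      by (intro CollectI exI[of _ G]) (simp add: G_def)
    have "{f \<in> ?V \<rightarrow>\<^sub>E {..<n}. inj_on f ?V \<and> restrict (col \<circ> f) ?V \<in> strong_homs ?V ?E {..<k - 1} (- Id)}
      \<subseteq> embeddings ?V ?E (pverts G) (parcs G)"
      by (auto simp: embeddings_def strong_homs_def G_def colour_graph_def PiE_def Pi_def)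
    then have "real (card {f \<in> ?V \<rightarrow>\<^sub>E {..<n}. inj_on f ?V
        \<and> restrict (col \<circ> f) ?V \<in> strong_homs ?V ?E {..<k - 1} (- Id)})
      \<le> real (card (embeddings ?V ?E (pverts G) (parcs G)))"
      using F.finite_V verts by (intro of_nat_mono card_mono) auto
    then have "fact ?s * real (n choose ?s) * hom_density ?V ?E {..<k - 1} (- Id) y
      \<le> ?A * real (induced_copies F G)"
      using le copies[of G] verts card_injections[OF F.finite_V n] by simp
    then have "fact ?s / ?A * hom_density ?V ?E {..<k - 1} (- Id) y \<le> induced_density F G"
      using A n verts by (simp add: induced_density_def field_simps)
    then show ?thesis using dens by blast
  qed
  have upper: "d \<le> real n ^ ?s / real (n choose ?s) / ?A * ?M"
    if n: "0 < n" and d: "d \<in> densities n" for n d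
  proof -
    obtain G :: "nat pair_pre_digraph" where G: "pair_graph G" "clique_free k G"
      and n': "card (pverts G) = n" and d: "d = induced_density F G"
      using d by (auto simp: densities_def)
    interpret G: pair_graph G by (rule G)
    let ?W = "pverts G" and ?D = "parcs G"
    have W: "finite ?W" by (rule G.pair_finite_verts)
    define y :: "nat \<Rightarrow> real" where "y = (\<lambda>_. 1 / real n)"
    have y: "y \<in> prob_weights ?W" using n n' by (simp add: y_def prob_weights_def)
    have "\<exists>K z. K \<subseteq> ?W \<and> (\<forall>a\<in>K. \<forall>b\<in>K. a \<noteq> b \<longrightarrow> (a, b) \<in> ?D) \<and> z \<in> prob_weights K
        \<and> hom_density ?V ?E ?W ?D y \<le> hom_density ?V ?E K (- Id) z"
      using W y by (rule F.hom_density_le_clique)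
        (use G.arcs_symmetric G.no_loops' in auto)
    then obtain K z where K: "K \<subseteq> ?W" "\<And>a b. a \<in> K \<Longrightarrow> b \<in> K \<Longrightarrow> a \<noteq> b \<Longrightarrow> (a, b) \<in> ?D"
      and z: "z \<in> prob_weights K"
      and le: "hom_density ?V ?E ?W ?D y \<le> hom_density ?V ?E K (- Id) z" by blast
    have "card K \<le> k - 1" using clique_free_card_less[OF G K] by simp
    then have hM: "hom_density ?V ?E ?W ?D y \<le> ?M"
      using le hom_density_clique_le_max[OF F.finite_V finite_subset[OF K(1) W] _ z, of "k - 1" ?E]
      by simp
    have "real (card (embeddings ?V ?E ?W ?D)) \<le> real (card (strong_homs ?V ?E ?W ?D))"
      using F.finite_V W by (intro of_nat_mono card_mono) (auto simp: embeddings_def)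
    also have "\<dots> = real n ^ ?s * hom_density ?V ?E ?W ?D y"
      using n by (simp add: hom_density_def y_def power_divide)
    also have "\<dots> \<le> real n ^ ?s * ?M" using hM by (intro mult_left_mono) auto
    finally have "?A * real (induced_copies F G) \<le> real n ^ ?s * ?M" using copies[OF W] by simp
    then have "real (induced_copies F G) \<le> real n ^ ?s * ?M / ?A"
      using A by (simp add: field_simps)
    then have "real (induced_copies F G) / real (n choose ?s)
        \<le> real n ^ ?s * ?M / ?A / real (n choose ?s)"
      by (rule divide_right_mono) simp
    then show ?thesis using n' by (simp add: d induced_density_def field_simps)
  qed
  have w: "(\<lambda>_. 1 / real (k - 1)) \<in> prob_weights {..<k - 1}"
    using k by (intro prob_weights_uniform) simp
  have at: "fact ?s / ?A * ?M \<le> inducibility_at k F n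
      \<and> inducibility_at k F n \<le> real n ^ ?s / real (n choose ?s) / ?A * ?M"
    if n: "?s < n" for n
  proof
    have max: "inducibility_at k F n = Max (densities n)"
      by (simp add: inducibility_at_def densities_def)
    have "densities n \<noteq> {}" using lower[OF less_imp_le[OF n] w] by auto
    then have "Max (densities n) \<in> densities n" using finite by simp
    then show "inducibility_at k F n \<le> real n ^ ?s / real (n choose ?s) / ?A * ?M"
      unfolding max using n by (intro upper) auto
    have "hom_density ?V ?E {..<k - 1} (- Id) y \<le> inducibility_at k F n * ?A / fact ?s"
      if y: "y \<in> prob_weights {..<k - 1}" for y
    proof -
      obtain d where "d \<in> densities n" "fact ?s / ?A * hom_density ?V ?E {..<k - 1} (- Id) y \<le> d"
        using lower[OF less_imp_le[OF n] y] by blast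
      then have "fact ?s / ?A * hom_density ?V ?E {..<k - 1} (- Id) y \<le> inducibility_at k F n"
        unfolding max using finite Max_ge order_trans by blast
      then show ?thesis using A by (simp add: field_simps)
    qed
    then have "?M \<le> inducibility_at k F n * ?A / fact ?s"
      unfolding max_hom_density_def using w by (intro cSUP_least) auto
    then show "fact ?s / ?A * ?M \<le> inducibility_at k F n"
      using A by (simp add: field_simps)
  qed
  have ev: "eventually (\<lambda>n. ?s < n) sequentially" by (rule eventually_gt_at_top)
  have "(\<lambda>n. inducibility_at k F n) \<longlonglongrightarrow> fact ?s / ?A * ?M"
  proof (rule tendsto_sandwich)
    show "(\<lambda>_. fact ?s / ?A * ?M) \<longlonglongrightarrow> fact ?s / ?A * ?M" by (rule tendsto_const)
    show "(\<lambda>n. real n ^ ?s / real (n choose ?s) / ?A * ?M) \<longlonglongrightarrow> fact ?s / ?A * ?M"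
      using A by (intro tendsto_intros power_over_choose_tendsto) simp
    show "eventually (\<lambda>n. fact ?s / ?A * ?M \<le> inducibility_at k F n) sequentially"
      using ev by eventually_elim (use at in blast)
    show "eventually (\<lambda>n. inducibility_at k F n
        \<le> real n ^ ?s / real (n choose ?s) / ?A * ?M) sequentially"
      using ev by eventually_elim (use at in blast)
  qed
  then show ?thesis unfolding inducibility_def by (rule limI)
qed

section \<open>Complete graphs: the density keeps growing\<close>

text \<open>
  The ends of an edge must receive different colours, but they collide with probability
  \<open>\<Sum>i. (y i)\<^sup>2\<close>, which is at least \<open>1 / N\<close>.
\<close>

lemma max_hom_density_le_if_edge:
  assumes V: "finite V" and E: "(u, v) \<in> E" "u \<in> V" "v \<in> V" "u \<noteq> v" and N: "0 < N"
  shows "max_hom_density V E N \<le> 1 - 1 / real N"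
  unfolding max_hom_density_def
proof (rule cSUP_least)
  show "prob_weights {..<N} \<noteq> {}" using prob_weights_uniform[OF N] by blast
  fix y assume y: "y \<in> prob_weights {..<N}"
  let ?W = "{..<N}"
  let ?w = "\<lambda>f. \<Prod>z\<in>V. y (f z)"
  let ?all = "V \<rightarrow>\<^sub>E ?W"
  have fin: "finite ?all" using V by (simp add: finite_PiE)
  have "hom_density V E ?W (- Id) y \<le> sum ?w (?all - {f \<in> ?all. f u = f v})"
    using V y E by (intro hom_density_le) (auto simp: strong_homs_def)
  also have "\<dots> = sum ?w ?all - sum ?w {f \<in> ?all. f u = f v}"
    using fin by (intro sum_diff) auto
  also have "\<dots> = 1 - (\<Sum>i\<in>?W. (y i)\<^sup>2)"
    using sum_prod_all_maps[OF V _ y] sum_prod_coincide[OF V _ y E(2,3,4)] by simp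
  also have "\<dots> \<le> 1 - 1 / real N"
    using sum_squares_ge_inverse_card[OF _ y] by simp
  finally show "hom_density V E ?W (- Id) y \<le> 1 - 1 / real N" .
qed

text \<open>
  With \<open>N\<close> equally likely colours each pair of vertices collides with probability \<open>1 / N\<close>; the
  estimate is the union bound over all pairs.
\<close>

lemma max_hom_density_ge_if_complete:
  assumes V: "finite V" and E: "E = {(u, v). u \<in> V \<and> v \<in> V \<and> u \<noteq> v}" and N: "0 < N"
  shows "1 - (real (card V))\<^sup>2 / real N \<le> max_hom_density V E N"
proof -
  let ?W = "{..<N}"
  define y where "y = (\<lambda>_::nat. 1 / real N)"
  have y: "y \<in> prob_weights ?W" unfolding y_def by (rule prob_weights_uniform[OF N])
  let ?w = "\<lambda>f. \<Prod>z\<in>V. y (f z)"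
  let ?all = "V \<rightarrow>\<^sub>E ?W" and ?H = "strong_homs V E ?W (- Id)"
  have fin: "finite ?all" using V by (simp add: finite_PiE)
  have EV: "E \<subseteq> V \<times> V" using E by auto
  then have finE: "finite E" using V finite_subset by blast
  have w0: "0 \<le> ?w f" for f by (intro prod_nonneg) (simp add: y_def)
  have "sum ?w (?all - ?H) \<le> (\<Sum>f\<in>?all - ?H. \<Sum>(u, v)\<in>E. if f u = f v then ?w f else 0)"
  proof (rule sum_mono)
    fix f assume f: "f \<in> ?all - ?H"
    then obtain u v where "u \<in> V" "v \<in> V" "\<not> ((u, v) \<in> E \<longleftrightarrow> f u \<noteq> f v)"
      by (auto simp: strong_homs_def)
    then have "(u, v) \<in> E" "f u = f v" using E by auto
    then have "?w f = (case (u, v) of (u, v) \<Rightarrow> if f u = f v then ?w f else 0)" by simp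
    also have "\<dots> \<le> (\<Sum>(u, v)\<in>E. if f u = f v then ?w f else 0)"
      using \<open>(u, v) \<in> E\<close> finE w0 by (intro member_le_sum) (auto split: if_splits)
    finally show "?w f \<le> (\<Sum>(u, v)\<in>E. if f u = f v then ?w f else 0)" .
  qed
  also have "\<dots> \<le> (\<Sum>f\<in>?all. \<Sum>(u, v)\<in>E. if f u = f v then ?w f else 0)"
    using fin w0 by (intro sum_mono2 sum_nonneg) auto
  also have "\<dots> = (\<Sum>(u, v)\<in>E. \<Sum>f\<in>?all. if f u = f v then ?w f else 0)"
    by (subst sum.swap) (simp add: case_prod_beta)
  also have "\<dots> = (\<Sum>(u, v)\<in>E. 1 / real N)"
  proof (intro sum.cong refl, clarify)
    fix u v assume "(u, v) \<in> E"
    have "(\<Sum>f\<in>?all. if f u = f v then ?w f else 0) = sum ?w {f \<in> ?all. f u = f v}"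
      using fin by (simp add: sum.inter_filter)
    also have "\<dots> = (\<Sum>i\<in>?W. (y i)\<^sup>2)"
      using \<open>(u, v) \<in> E\<close> E y V by (intro sum_prod_coincide) auto
    also have "\<dots> = 1 / real N" using N by (simp add: y_def power2_eq_square)
    finally show "(\<Sum>f\<in>?all. if f u = f v then ?w f else 0) = 1 / real N" .
  qed
  also have "\<dots> = real (card E) / real N" by simp
  also have "\<dots> \<le> (real (card V))\<^sup>2 / real N"
  proof (rule divide_right_mono)
    have "card E \<le> card V * card V"
      using card_mono[OF _ EV] V by (simp add: card_cartesian_product)
    then show "real (card E) \<le> (real (card V))\<^sup>2"
      by (metis of_nat_mono of_nat_mult power2_eq_square)
  qed simp
  finally have "sum ?w (?all - ?H) \<le> (real (card V))\<^sup>2 / real N" .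
  moreover have "sum ?w (?all - ?H) = sum ?w ?all - sum ?w ?H"
    by (rule sum_diff[OF fin strong_homs_subset])
  ultimately have "1 - (real (card V))\<^sup>2 / real N \<le> sum ?w ?H"
    using sum_prod_all_maps[OF V _ y] by simp
  also have "\<dots> \<le> max_hom_density V E N"
    using hom_density_clique_le_max[OF V _ _ y, of N E] by (simp add: hom_density_def)
  finally show ?thesis .
qed

section \<open>Other graphs: finitely many colours suffice\<close>

context complete_multipartite
begin

text \<open>
  There are at most \<open>card V\<close> parts, so giving each part its own colour is a strong homomorphism.
\<close>

lemma max_hom_density_pos:
  assumes "V \<noteq> {}"
  shows "0 < max_hom_density V E (card V)"
proof -
  let ?s = "card V"
  have s: "0 < ?s" using assms finite_V by (simp add: card_gt_0_iff)
  define part where "part v = {u \<in> V. (u, v) \<notin> E}" for v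
  have part: "part u = part v \<longleftrightarrow> (u, v) \<notin> E" if "u \<in> V" "v \<in> V" for u v
  proof
    assume "part u = part v"
    then have "u \<in> part v" using that irrefl_E by (auto simp: part_def)
    then show "(u, v) \<notin> E" by (simp add: part_def)
  next
    assume "(u, v) \<notin> E"
    moreover from this have "(v, u) \<notin> E" using sym_E that by blast
    ultimately show "part u = part v" unfolding part_def using nonadj_trans that by blast
  qed
  obtain idx where idx: "bij_betw idx (part ` V) {..<card (part ` V)}"
    using ex_bij_betw_finite_nat[of "part ` V"] finite_V by (auto simp: atLeast0LessThan)
  have le: "card (part ` V) \<le> ?s" using finite_V by (rule card_image_le)
  define f where "f = restrict (idx \<circ> part) V"
  have "f \<in> strong_homs V E {..<?s} (- Id)"
  proof -
    have "idx (part v) < ?s" if "v \<in> V" for v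
      using bij_betwE[OF idx] that le by fastforce
    moreover have "idx (part u) = idx (part v) \<longleftrightarrow> (u, v) \<notin> E" if "u \<in> V" "v \<in> V" for u v
      using part[OF that] idx that by (auto simp: bij_betw_def inj_on_def)
    ultimately show ?thesis by (auto simp: strong_homs_def f_def)
  qed
  then have "(\<Prod>v\<in>V. 1 / real ?s) \<le> hom_density V E {..<?s} (- Id) (\<lambda>_. 1 / real ?s)"
    unfolding hom_density_def using finite_V by (intro member_le_sum) auto
  also have "\<dots> \<le> max_hom_density V E ?s"
    using prob_weights_uniform[OF s] by (intro hom_density_clique_le_max finite_V) auto
  finally have "(\<Prod>v\<in>V. 1 / real ?s) \<le> max_hom_density V E ?s" .
  moreover have "0 < (\<Prod>v\<in>V. 1 / real ?s)" using s by (intro prod_pos) auto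
  ultimately show ?thesis by linarith
qed

text \<open>
  Let \<open>i\<close> be a colour of weight at most \<open>1 / N\<close>. A strong homomorphism that uses \<open>i\<close> uses it on a
  whole part, hence at least twice, so these contribute at most \<open>card V * (y i)\<^sup>2\<close>. Deleting \<open>i\<close> and
  rescaling gains a factor that is linear in \<open>y i\<close>, which wins when \<open>N\<close> is large.
\<close>

lemma hom_density_drop_small_weight:
  assumes parts: "\<And>v. v \<in> V \<Longrightarrow> \<exists>v'\<in>V. v' \<noteq> v \<and> (v, v') \<notin> E"
    and V: "V \<noteq> {}" and N: "2 \<le> N" and y: "y \<in> prob_weights {..<N}"
    and large: "real (card V) / real N \<le> max_hom_density V E (N - 1)"
  shows "hom_density V E {..<N} (- Id) y \<le> max_hom_density V E (N - 1)"
proof -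
  let ?W = "{..<N}" and ?s = "card V" and ?M = "max_hom_density V E (N - 1)"
  let ?w = "\<lambda>f. \<Prod>v\<in>V. y (f v)"
  have s: "1 \<le> ?s" using V finite_V by (simp add: Suc_le_eq card_gt_0_iff)
  obtain i where i: "i \<in> ?W" "y i \<le> 1 / real N"
  proof (rule ccontr)
    assume "\<not> thesis"
    then have "1 / real N < y i" if "i \<in> ?W" for i using that \<open>\<And>i. _ \<Longrightarrow> _ \<Longrightarrow> thesis\<close> by force
    then have "(\<Sum>i\<in>?W. 1 / real N) < sum y ?W" using N by (intro sum_strict_mono) (auto simp: lessThan_empty_iff)
    then show False using N y by (simp add: prob_weights_def)
  qed
  have y0: "0 \<le> y j" if "j \<in> ?W" for j using y that by (simp add: prob_weights_def)
  define q where "q = 1 - y i"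
  have "1 / real N \<le> 1 / 2" using N by simp
  then have q: "0 < q" "q \<le> 1" using i(2) y0[OF i(1)] unfolding q_def by linarith+
  have sum_rest: "sum y (?W - {i}) = q" using y i by (simp add: sum_diff1 prob_weights_def q_def)
  let ?H = "strong_homs V E ?W (- Id)" and ?H' = "strong_homs V E (?W - {i}) (- Id)"
  have finH: "finite ?H" using finite_V by simp
  have "sum ?w ?H' = (\<Sum>f\<in>?H'. q ^ ?s * (\<Prod>v\<in>V. y (f v) / q))"
    using q by (simp add: prod_dividef)
  also have "\<dots> = q ^ ?s * hom_density V E (?W - {i}) (- Id) (\<lambda>j. y j / q)"
    by (simp add: hom_density_def sum_distrib_left)
  also have "\<dots> \<le> q ^ ?s * ?M"
  proof (intro mult_left_mono hom_density_clique_le_max finite_V)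
    show "(\<lambda>j. y j / q) \<in> prob_weights (?W - {i})"
      using sum_rest q y0 by (simp add: prob_weights_def flip: sum_divide_distrib)
  qed (use i q in auto)
  also have "\<dots> \<le> q ^ 1 * ?M"
  proof (intro mult_right_mono power_decreasing s)
    have "0 \<le> real ?s / real N" by simp
    then show "0 \<le> ?M" using large by (rule order_trans)
  qed (use q in auto)
  finally have avoid: "sum ?w ?H' \<le> q * ?M" by simp
  have "sum ?w (?H - ?H') \<le> (\<Sum>f\<in>?H - ?H'. \<Sum>v\<in>V. if f v = i then ?w f else 0)"
  proof (rule sum_mono)
    fix f assume f: "f \<in> ?H - ?H'"
    then obtain v where v: "v \<in> V" "f v = i" by (auto simp: strong_homs_def PiE_def Pi_def)
    have "0 \<le> ?w f" using f y by (intro prod_weights_nonneg) (auto simp: strong_homs_def)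
    then have "(if f v = i then ?w f else 0) \<le> (\<Sum>v\<in>V. if f v = i then ?w f else 0)"
      using v finite_V by (intro member_le_sum) auto
    then show "?w f \<le> (\<Sum>v\<in>V. if f v = i then ?w f else 0)" using v by simp
  qed
  also have "\<dots> = (\<Sum>v\<in>V. \<Sum>f\<in>?H - ?H'. if f v = i then ?w f else 0)" by (rule sum.swap)
  also have "\<dots> \<le> (\<Sum>v\<in>V. (y i)\<^sup>2)"
  proof (rule sum_mono)
    fix v assume v: "v \<in> V"
    then obtain v' where v': "v' \<in> V" "v' \<noteq> v" "(v, v') \<notin> E" using parts by blast
    have "(\<Sum>f\<in>?H - ?H'. if f v = i then ?w f else 0) = sum ?w {f \<in> ?H - ?H'. f v = i}"
      by (rule sum.inter_filter[symmetric]) (use finH in simp)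
    also have "\<dots> \<le> sum ?w {f \<in> V \<rightarrow>\<^sub>E ?W. f v = i \<and> f v' = i}"
    proof (rule sum_mono2)
      show "finite {f \<in> V \<rightarrow>\<^sub>E ?W. f v = i \<and> f v' = i}" using finite_PiE[of V "\<lambda>_. ?W"] finite_V by simp
      show "{f \<in> ?H - ?H'. f v = i} \<subseteq> {f \<in> V \<rightarrow>\<^sub>E ?W. f v = i \<and> f v' = i}"
        using v v' by (auto simp: strong_homs_def)
      show "0 \<le> ?w f"
        if "f \<in> {f \<in> V \<rightarrow>\<^sub>E ?W. f v = i \<and> f v' = i} - {f \<in> ?H - ?H'. f v = i}" for f
        using that by (intro prod_weights_nonneg[OF y]) simp
    qed
    also have "\<dots> = (y i)\<^sup>2" using v v' i y finite_V by (intro sum_prod_both_at) auto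
    finally show "(\<Sum>f\<in>?H - ?H'. if f v = i then ?w f else 0) \<le> (y i)\<^sup>2" .
  qed
  also have "\<dots> = (real ?s * y i) * y i" by (simp add: power2_eq_square)
  also have "\<dots> \<le> ?M * y i"
  proof (rule mult_right_mono)
    have "real ?s * y i \<le> real ?s * (1 / real N)" using i by (intro mult_left_mono) auto
    then show "real ?s * y i \<le> ?M" using large by simp
  qed (rule y0[OF i(1)])
  finally have hit: "sum ?w (?H - ?H') \<le> ?M * y i" .
  have "?H' \<subseteq> ?H" by (auto simp: strong_homs_def PiE_def Pi_def)
  then have "sum ?w ?H = sum ?w (?H - ?H') + sum ?w ?H'" using finH by (rule sum.subset_diff)
  also have "\<dots> \<le> ?M * y i + q * ?M" using avoid hit by simp
  also have "\<dots> = ?M" by (simp add: q_def algebra_simps)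
  finally show ?thesis by (simp add: hom_density_def)
qed

lemma max_hom_density_stable_if_parts_large:
  assumes parts: "\<And>v. v \<in> V \<Longrightarrow> \<exists>v'\<in>V. v' \<noteq> v \<and> (v, v') \<notin> E" and V: "V \<noteq> {}"
  shows "\<exists>N0\<ge>1. \<forall>N. N0 \<le> N \<longrightarrow> max_hom_density V E N \<le> max_hom_density V E N0"
proof -
  let ?s = "card V" and ?M = "max_hom_density V E"
  have s: "1 \<le> ?s" using V finite_V by (simp add: Suc_le_eq card_gt_0_iff)
  have pos: "0 < ?M ?s" using max_hom_density_pos[OF V] .
  \<comment> \<open>From \<open>L\<close> colours on, a least weight is small enough for
     \<open>hom_density_drop_small_weight\<close> to apply.\<close>
  obtain L where L: "real ?s / ?M ?s \<le> real L" using real_arch_simple by blast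
  define N0 where "N0 = max ?s L"
  have "?M N \<le> ?M N0" if "N0 \<le> N" for N
    using that
  proof (induction N rule: dec_induct)
    case (step n)
    have n: "?s \<le> n" "L \<le> n" "1 \<le> n" using step(1) s by (auto simp: N0_def)
    have "real ?s / ?M ?s \<le> real (Suc n)" using L n by linarith
    then have "real ?s / real (Suc n) \<le> ?M ?s" using pos by (simp add: field_simps)
    also have "\<dots> \<le> ?M n" using finite_V s n by (intro max_hom_density_mono) auto
    finally have large: "real ?s / real (Suc n) \<le> ?M (Suc n - 1)" by simp
    have "?M (Suc n) \<le> ?M n"
      unfolding max_hom_density_def[of V E "Suc n"]
    proof (rule cSUP_least)
      show "prob_weights {..<Suc n} \<noteq> {}" using prob_weights_uniform[of "Suc n"] by blast
      fix y assume "y \<in> prob_weights {..<Suc n}"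
      from hom_density_drop_small_weight[OF parts V _ this large] n
      show "hom_density V E {..<Suc n} (- Id) y \<le> ?M n" by simp
    qed
    then show ?case using step.IH by simp
  qed simp
  moreover have "1 \<le> N0" using s by (simp add: N0_def)
  ultimately show ?thesis by blast
qed

text \<open>
  Vary the weights of two colours \<open>a\<close> and \<open>b\<close> with their sum \<open>S\<close> fixed. By the symmetry between
  \<open>a\<close> and \<open>b\<close> the density is a combination, with non-negative coefficients, of the polynomials
  \<open>s ^ i * t ^ j + t ^ i * s ^ j\<close>, where \<open>i\<close> and \<open>j\<close> are the numbers of vertices coloured \<open>a\<close> and
  \<open>b\<close>. As parts have at most two vertices, \<open>i\<close> and \<open>j\<close> are at most \<open>2\<close>, and then each of these
  polynomials is an affine function of the product \<open>s * t\<close>, except for \<open>2 * (s * t)\<^sup>2\<close>, which is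
  convex in it. So the density is a convex function of \<open>s * t\<close>; the statement compares the value at
  \<open>s * t\<close> with those at the products \<open>0\<close> and \<open>s' * t'\<close>.
\<close>

lemma hom_density_pair_convex:
  assumes parts: "\<And>v. v \<in> V \<Longrightarrow> card {u \<in> V. (u, v) \<notin> E} \<le> 2"
    and K: "finite K" "a \<in> K" "b \<in> K" "a \<noteq> b" and z: "\<And>c. c \<in> K \<Longrightarrow> 0 \<le> z c"
    and st: "s + t = S" "s' + t' = S" "s * t = (1 - \<mu>) * (s' * t')" "0 \<le> \<mu>" "\<mu> \<le> 1"
  shows "hom_density V E K (- Id) (z(a := s, b := t))
    \<le> \<mu> * hom_density V E K (- Id) (z(a := S, b := 0))
      + (1 - \<mu>) * hom_density V E K (- Id) (z(a := s', b := t'))"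
proof -
  let ?H = "strong_homs V E K (- Id)"
  define e where "e c f = card {v \<in> V. f v = c}" for c and f :: "'a \<Rightarrow> 'b"
  \<comment> \<open>The contribution of the vertices coloured neither \<open>a\<close> nor \<open>b\<close>.\<close>
  define r where "r f = (\<Prod>v\<in>V. if f v = a \<or> f v = b then 1 else z (f v))" for f
  have fibre: "e c f \<le> 2" if "f \<in> ?H" for c f
  proof (cases "\<exists>v\<in>V. f v = c")
    case True
    then obtain v where v: "v \<in> V" "f v = c" by blast
    then have "{u \<in> V. f u = c} \<subseteq> {u \<in> V. (u, v) \<notin> E}"
      using that by (auto simp: strong_homs_def)
    then have "e c f \<le> card {u \<in> V. (u, v) \<notin> E}"
      unfolding e_def using finite_V by (intro card_mono) auto
    then show ?thesis using parts[OF v(1)] by simp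
  next
    case False
    then have "{u \<in> V. f u = c} = {}" by auto
    then show ?thesis by (simp only: e_def card.empty)
  qed
  have r0: "0 \<le> r f" if "f \<in> ?H" for f
    unfolding r_def using z that by (intro prod_nonneg) (auto simp: strong_homs_def)
  have mono: "(\<Prod>v\<in>V. (z(a := x, b := w)) (f v)) = r f * (x ^ e a f * w ^ e b f)" for f x w
  proof -
    have "(\<Prod>v\<in>V. (z(a := x, b := w)) (f v))
      = (\<Prod>v\<in>V. (if f v = a \<or> f v = b then 1 else z (f v))
          * ((if f v = a then x else 1) * (if f v = b then w else 1)))"
      using K(4) by (intro prod.cong) auto
    also have "\<dots> = r f * (x ^ e a f * w ^ e b f)"
      using finite_V by (simp add: prod.distrib r_def e_def prod.If_cases Int_def)
    finally show ?thesis .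
  qed
  define P where "P x w = hom_density V E K (- Id) (z(a := x, b := w))" for x w
  have P: "P x w = (\<Sum>f\<in>?H. r f * (x ^ e a f * w ^ e b f))" for x w
    unfolding P_def hom_density_def mono ..
  have swap: "P x w = P w x" for x w
  proof -
    define g where "g c = (if c = a then b else if c = b then a else c)" for c
    have "hom_density V E K (- Id) (z(a := x, b := w))
      = hom_density V E K (- Id) (z(a := x, b := w) \<circ> g)"
    proof (rule hom_density_relabel)
      show "bij_betw g K K"
        using K by (intro bij_betw_byWitness[of _ g]) (auto simp: g_def)
      show "(g c, g d) \<in> - Id \<longleftrightarrow> (c, d) \<in> - Id" for c d by (auto simp: g_def split: if_splits)
    qed
    also have "z(a := x, b := w) \<circ> g = z(a := w, b := x)" using K(4) by (auto simp: g_def)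
    finally show ?thesis unfolding P_def .
  qed
  define h where "h x w f = x ^ e a f * w ^ e b f + w ^ e a f * x ^ e b f" for x w :: real and f
  have Ph: "2 * P x w = (\<Sum>f\<in>?H. r f * h x w f)" for x w
  proof -
    have "2 * P x w = P x w + P w x" using swap[of x w] by simp
    also have "\<dots> = (\<Sum>f\<in>?H. r f * h x w f)" by (simp add: P h_def sum.distrib distrib_left)
    finally show ?thesis .
  qed
  have h: "h s t f \<le> \<mu> * h S 0 f + (1 - \<mu>) * h s' t' f" if f: "f \<in> ?H" for f
  proof -
    have "s = S - t" "s' = S - t'" using st by auto
    have p2: "(s * t)\<^sup>2 \<le> (1 - \<mu>) * (s' * t')\<^sup>2"
    proof -
      have "(s * t)\<^sup>2 = (1 - \<mu>) * ((1 - \<mu>) * (s' * t')\<^sup>2)" using st(3) by (simp add: power2_eq_square)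
      also have "\<dots> \<le> (1 - \<mu>) * (1 * (s' * t')\<^sup>2)"
        using st by (intro mult_left_mono mult_right_mono) auto
      finally show ?thesis by simp
    qed
    have sq: "x\<^sup>2 + w\<^sup>2 = S\<^sup>2 - 2 * (x * w)" and cu: "x\<^sup>2 * w + w\<^sup>2 * x = S * (x * w)"
      if "x + w = S" for x w
      unfolding that[symmetric] by (simp_all add: power2_eq_square algebra_simps)
    have sums: "s\<^sup>2 + t\<^sup>2 = \<mu> * S\<^sup>2 + (1 - \<mu>) * (s'\<^sup>2 + t'\<^sup>2)"
      unfolding sq[OF st(1)] sq[OF st(2)] st(3) by (simp add: algebra_simps)
    have cubes: "s\<^sup>2 * t + t\<^sup>2 * s = (1 - \<mu>) * (s'\<^sup>2 * t' + t'\<^sup>2 * s')"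
      unfolding cu[OF st(1)] cu[OF st(2)] st(3) by (simp add: algebra_simps)
    have lin: "s + t = \<mu> * S + (1 - \<mu>) * (s' + t')" using st by (simp add: algebra_simps)
    have "e a f \<in> {0, 1, 2}" "e b f \<in> {0, 1, 2}" using fibre[OF f, of a] fibre[OF f, of b] by auto
    then consider "e a f = 0" "e b f = 0" | "e a f = 0 \<and> e b f = 1 \<or> e a f = 1 \<and> e b f = 0"
      | "e a f = 0 \<and> e b f = 2 \<or> e a f = 2 \<and> e b f = 0" | "e a f = 1" "e b f = 1"
      | "e a f = 1 \<and> e b f = 2 \<or> e a f = 2 \<and> e b f = 1" | "e a f = 2" "e b f = 2"
      by auto
    then show ?thesis
    proof cases
      case 1 then show ?thesis by (simp add: h_def)
    next
      case 2 then show ?thesis using lin by (auto simp: h_def add.commute)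
    next
      case 3 then show ?thesis using sums by (auto simp: h_def add.commute)
    next
      case 4 then show ?thesis using st(3) by (simp add: h_def mult.commute)
    next
      case 5 then show ?thesis using cubes by (auto simp: h_def algebra_simps)
    next
      case 6 then show ?thesis using p2 by (simp add: h_def power_mult_distrib mult.commute)
    qed
  qed
  have "2 * P s t \<le> (\<Sum>f\<in>?H. r f * (\<mu> * h S 0 f + (1 - \<mu>) * h s' t' f))"
    unfolding Ph using h r0 by (intro sum_mono mult_left_mono) auto
  also have "\<dots> = \<mu> * (2 * P S 0) + (1 - \<mu>) * (2 * P s' t')"
    unfolding Ph sum_distrib_left sum.distrib[symmetric]
    by (intro sum.cong refl) (simp add: algebra_simps)
  finally show ?thesis by (simp add: P_def)
qed

text \<open>
  Smoothing. If the weights are not all equal to their mean \<open>1 / card K\<close>, take one below and one above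
  it. Moving the lower one up to the mean, and the upper one down by the same amount, increases their
  product; so by convexity in the product either this move or merging the two weights into one does not
  decrease the density. The first increases the number of weights equal to the mean, the second
  decreases the number of colours in use, so the process ends with uniform weights.
\<close>

lemma hom_density_le_uniform:
  assumes parts: "\<And>v. v \<in> V \<Longrightarrow> card {u \<in> V. (u, v) \<notin> E} \<le> 2"
    and "finite K" "y \<in> prob_weights K"
  shows "\<exists>l\<in>{1..card K}. hom_density V E K (- Id) y \<le> hom_density V E {..<l} (- Id) (\<lambda>_. 1 / real l)"
  using assms(2,3)
proof (induction K arbitrary: y rule: finite_psubset_induct)
  case (psubset K)
  let ?l = "card K" and ?P = "\<lambda>K. hom_density V E K (- Id)"
  note K = \<open>finite K\<close>
  show ?case
    using psubset.prems
  proof (induction "card {c \<in> K. y c \<noteq> 1 / real ?l}" arbitrary: y rule: less_induct)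
    case less
    have y0: "0 \<le> y c" if "c \<in> K" for c using less.prems that by (simp add: prob_weights_def)
    have total: "sum y K = 1" using less.prems by (simp add: prob_weights_def)
    have "K \<noteq> {}" using total by auto
    then have l: "0 < ?l" using K by (simp add: card_gt_0_iff)
    have drop: "\<exists>l\<in>{1..card K}. ?P K x \<le> ?P {..<l} (\<lambda>_. 1 / real l)"
      if x: "x \<in> prob_weights K" "c \<in> K" "x c = 0" for x c
    proof -
      have "?P K x = ?P (K - {c}) x"
        using x K finite_V by (intro hom_density_zero_extend) auto
      moreover have "x \<in> prob_weights (K - {c})"
        using x K by (auto simp: prob_weights_def sum_diff1)
      moreover have "K - {c} \<subset> K" "card (K - {c}) \<le> card K" using x(2) K by (auto simp: card_Diff1_le)
      ultimately show ?thesis using psubset.IH[of "K - {c}" x] by force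
    qed
    show ?case
    proof (cases "\<exists>c\<in>K. y c = 0")
      case True
      then show ?thesis using drop less.prems by blast
    next
      case no_zero: False
      show ?thesis
      proof (cases "\<forall>c\<in>K. y c = 1 / real ?l")
        case True
        obtain g where g: "bij_betw g {..<?l} K"
          using ex_bij_betw_nat_finite[OF K] by (auto simp: atLeast0LessThan)
        have "?P K y = ?P {..<?l} (y \<circ> g)"
          using g by (intro hom_density_relabel) (auto simp: bij_betw_def inj_on_def)
        also have "\<dots> = ?P {..<?l} (\<lambda>_. 1 / real ?l)"
          unfolding hom_density_def using True bij_betwE[OF g]
          by (intro sum.cong prod.cong) (auto simp: strong_homs_def PiE_def Pi_def)
        finally show ?thesis using l by (intro bexI[of _ ?l]) auto
      next
        case False
        have const: "(\<Sum>c\<in>K. 1 / real ?l) = 1" using l by simp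
        obtain a where a: "a \<in> K" "y a < 1 / real ?l"
        proof (rule ccontr)
          assume "\<not> thesis"
          then have "\<forall>c\<in>K. 1 / real ?l \<le> y c" using that by force
          moreover from this False have "\<exists>c\<in>K. 1 / real ?l < y c" by force
          ultimately have "(\<Sum>c\<in>K. 1 / real ?l) < sum y K" using K by (intro sum_strict_mono_ex1) auto
          then show False using const total by simp
        qed
        obtain b where b: "b \<in> K" "1 / real ?l < y b"
        proof (rule ccontr)
          assume "\<not> thesis"
          then have "\<forall>c\<in>K. y c \<le> 1 / real ?l" using that by force
          then have "sum y K < (\<Sum>c\<in>K. 1 / real ?l)" using K a by (intro sum_strict_mono_ex1) auto
          then show False using const total by simp
        qed
        have ab: "a \<noteq> b" using a b by auto
        have ya: "0 < y a" using y0[OF a(1)] no_zero a(1) by force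
        define S where "S = y a + y b"
        define s' where "s' = 1 / real ?l"
        define t' where "t' = S - s'"
        \<comment> \<open>The product \<open>y a * y b\<close> is the mean of \<open>0\<close> and \<open>s' * t'\<close> with weights \<open>\<mu>\<close> and \<open>1 - \<mu>\<close>.\<close>
        define \<mu> where "\<mu> = 1 - (y a * y b) / (s' * t')"
        have "0 < s'" using l by (simp add: s'_def)
        then have pos: "0 < s'" "0 < t'" "0 < y b" "0 \<le> S"
          using ya b(2) unfolding t'_def S_def s'_def by linarith+
        have "0 \<le> (s' - y a) * (y b - s')" using a b by (simp add: s'_def)
        also have "\<dots> = s' * t' - y a * y b" by (simp add: t'_def S_def algebra_simps)
        finally have "y a * y b \<le> s' * t'" by simp
        then have mu: "0 \<le> \<mu>" "\<mu> \<le> 1" "y a * y b = (1 - \<mu>) * (s' * t')"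
          using pos ya by (auto simp: \<mu>_def divide_le_eq)
        define y1 where "y1 = y(a := S, b := 0)"
        define y2 where "y2 = y(a := s', b := t')"
        have weights: "y(a := x, b := w) \<in> prob_weights K" if "0 \<le> x" "0 \<le> w" "x + w = S" for x w
        proof -
          have split: "sum f K = f a + f b + sum f (K - {a} - {b})" for f :: "_ \<Rightarrow> real"
            using K a b ab by (simp add: sum.remove[of K a] sum.remove[of "K - {a}" b])
          have "sum (y(a := x, b := w)) K = x + w + sum y (K - {a} - {b})"
            unfolding split using ab by simp
          also have "\<dots> = sum y K" unfolding split[of y] using that(3) by (simp add: S_def)
          finally show ?thesis using that y0 total by (auto simp: prob_weights_def)
        qed
        have w1: "y1 \<in> prob_weights K" unfolding y1_def using pos by (intro weights) auto
        have w2: "y2 \<in> prob_weights K" unfolding y2_def using pos by (intro weights) (auto simp: t'_def)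
        have "?P K (y(a := y a, b := y b)) \<le> \<mu> * ?P K y1 + (1 - \<mu>) * ?P K y2"
          unfolding y1_def y2_def
          using parts K a b ab y0 mu by (intro hom_density_pair_convex) (auto simp: S_def t'_def)
        also have "\<dots> \<le> max (?P K y1) (?P K y2)" using mu by (intro convex_bound_le) auto
        finally have le: "?P K y \<le> ?P K y1 \<or> ?P K y \<le> ?P K y2" by auto
        have "{c \<in> K. y2 c \<noteq> 1 / real ?l} \<subset> {c \<in> K. y c \<noteq> 1 / real ?l}"
        proof
          show "{c \<in> K. y2 c \<noteq> 1 / real ?l} \<subseteq> {c \<in> K. y c \<noteq> 1 / real ?l}"
          proof
            fix c assume c: "c \<in> {c \<in> K. y2 c \<noteq> 1 / real ?l}"
            then have "c \<noteq> a" using ab by (auto simp: y2_def s'_def)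
            with c b(2) show "c \<in> {c \<in> K. y c \<noteq> 1 / real ?l}"
              by (cases "c = b") (simp_all add: y2_def)
          qed
          have "y2 a = 1 / real ?l" "y a \<noteq> 1 / real ?l" using a(2) ab by (simp_all add: y2_def s'_def)
          then show "{c \<in> K. y2 c \<noteq> 1 / real ?l} \<noteq> {c \<in> K. y c \<noteq> 1 / real ?l}"
            using a(1) by blast
        qed
        then have "card {c \<in> K. y2 c \<noteq> 1 / real ?l} < card {c \<in> K. y c \<noteq> 1 / real ?l}"
          using K by (intro psubset_card_mono) auto
        then have "\<exists>l\<in>{1..card K}. ?P K y2 \<le> ?P {..<l} (\<lambda>_. 1 / real l)"
          using w2 by (rule less.hyps)
        moreover have "\<exists>l\<in>{1..card K}. ?P K y1 \<le> ?P {..<l} (\<lambda>_. 1 / real l)"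
          using w1 b(1) by (rule drop) (simp add: y1_def)
        ultimately show ?thesis using le order_trans by meson
      qed
    qed
  qed
qed

text \<open>
  Only uniform weights compete, and with \<open>l\<close> equally likely colours the two non-adjacent vertices
  \<open>u\<close> and \<open>v\<close> receive the same colour with probability only \<open>1 / l\<close>. Hence large numbers of colours
  cannot beat the positive density reached with \<open>card V\<close> colours.
\<close>

lemma max_hom_density_stable_if_parts_small:
  assumes parts: "\<And>v. v \<in> V \<Longrightarrow> card {u \<in> V. (u, v) \<notin> E} \<le> 2"
    and uv: "u \<in> V" "v \<in> V" "u \<noteq> v" "(u, v) \<notin> E"
  shows "\<exists>N0\<ge>1. \<forall>N. N0 \<le> N \<longrightarrow> max_hom_density V E N \<le> max_hom_density V E N0"
proof -
  let ?s = "card V" and ?M = "max_hom_density V E"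
  have V: "V \<noteq> {}" using uv by auto
  have s: "1 \<le> ?s" using V finite_V by (simp add: Suc_le_eq card_gt_0_iff)
  have pos: "0 < ?M ?s" using max_hom_density_pos[OF V] .
  \<comment> \<open>Beyond \<open>L\<close> colours, uniform weights give a density below \<open>?M ?s\<close>.\<close>
  obtain L where L: "1 / ?M ?s \<le> real L" using real_arch_simple by blast
  define N0 where "N0 = max ?s L"
  have "1 \<le> N0" "?s \<le> N0" using s by (auto simp: N0_def)
  have uniform: "hom_density V E {..<l} (- Id) (\<lambda>_. 1 / real l) \<le> ?M N0" if l: "1 \<le> l" for l
  proof (cases "l \<le> N0")
    case True
    then show ?thesis
      using l prob_weights_uniform[of l] by (intro hom_density_clique_le_max finite_V) auto
  next
    case False
    have w: "(\<lambda>_. 1 / real l) \<in> prob_weights {..<l}" using l by (intro prob_weights_uniform) simp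
    have "hom_density V E {..<l} (- Id) (\<lambda>_. 1 / real l)
      \<le> (\<Sum>f\<in>{f \<in> V \<rightarrow>\<^sub>E {..<l}. f u = f v}. \<Prod>z\<in>V. 1 / real l)"
      using w finite_V uv by (intro hom_density_le) (auto simp: strong_homs_def)
    also have "\<dots> = (\<Sum>i\<in>{..<l}. (1 / real l)\<^sup>2)"
      using sum_prod_coincide[OF finite_V _ w uv(1-3)] by simp
    also have "\<dots> = 1 / real l" using l by (simp add: power2_eq_square)
    also have "\<dots> \<le> ?M ?s"
    proof -
      have "1 / ?M ?s \<le> real l" using L False by (simp add: N0_def)
      then show ?thesis using pos l by (simp add: field_simps)
    qed
    also have "\<dots> \<le> ?M N0" using finite_V s \<open>?s \<le> N0\<close> by (intro max_hom_density_mono) auto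
    finally show ?thesis .
  qed
  have "?M N \<le> ?M N0" if "N0 \<le> N" for N
    unfolding max_hom_density_def[of V E N]
  proof (rule cSUP_least)
    show "prob_weights {..<N} \<noteq> {}" using prob_weights_uniform[of N] that \<open>1 \<le> N0\<close> by auto
    fix y assume "y \<in> prob_weights {..<N}"
    then obtain l where "1 \<le> l"
      "hom_density V E {..<N} (- Id) y \<le> hom_density V E {..<l} (- Id) (\<lambda>_. 1 / real l)"
      using hom_density_le_uniform[OF parts, of "{..<N}" y] by auto
    then show "hom_density V E {..<N} (- Id) y \<le> ?M N0" using uniform[of l] by simp
  qed
  then show ?thesis using \<open>1 \<le> N0\<close> by blast
qed

end

section \<open>Turan graphs\<close>

lemma turan_graph_complete_iff:
  assumes "turan_graph s r F"
  shows "complete_digraph s (with_proj F) \<longleftrightarrow> r = s"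
proof -
  let ?V = "pverts F"
  from assms obtain P where F: "pair_graph F" and s: "card ?V = s" and P: "partition_on ?V P"
    and r: "card P = r"
    and E: "parcs F = {(u, v). u \<in> ?V \<and> v \<in> ?V \<and> \<not> (\<exists>A\<in>P. u \<in> A \<and> v \<in> A)}"
    unfolding turan_graph_def by blast
  interpret F: pair_graph F by (rule F)
  have V: "finite ?V" by (rule F.pair_finite_verts)
  have finP: "finite P" using finite_elements[OF V P] .
  have nonempty: "1 \<le> card A" if "A \<in> P" for A
    using that P V partition_onD1[OF P] partition_onD3[OF P]
    by (metis One_nat_def Suc_leI Union_upper card_gt_0_iff finite_subset)
  have "finite A" if "A \<in> P" for A
    using nonempty[OF that] by (auto intro: card_ge_0_finite)
  then have total: "s = (\<Sum>A\<in>P. card A)" using product_partition[OF P] s by simp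
  have "r = s \<longleftrightarrow> (\<forall>A\<in>P. card A = 1)"
  proof
    assume "r = s"
    then have "(\<Sum>A\<in>P. card A) = (\<Sum>A\<in>P. 1)" using total r by simp
    then show "\<forall>A\<in>P. card A = 1"
      using nonempty finP sum_mono_inv[of "\<lambda>_. 1" P card] by metis
  next
    assume "\<forall>A\<in>P. card A = 1"
    then show "r = s" using total r by simp
  qed
  also have "\<dots> \<longleftrightarrow> (\<forall>A\<in>P. \<forall>u\<in>A. \<forall>v\<in>A. u = v)"
  proof (intro ball_cong refl)
    fix A assume "A \<in> P"
    then have "finite A" "A \<noteq> {}"
      using nonempty[of A] by (auto simp: card_gt_0_iff Suc_le_eq)
    then show "card A = 1 \<longleftrightarrow> (\<forall>u\<in>A. \<forall>v\<in>A. u = v)"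
      by (metis card_1_singletonE is_singletonI' is_singleton_altdef singletonD)
  qed
  also have "\<dots> \<longleftrightarrow> parcs F = {(u, v). u \<in> ?V \<and> v \<in> ?V \<and> u \<noteq> v}"
  proof
    assume trivial: "\<forall>A\<in>P. \<forall>u\<in>A. \<forall>v\<in>A. u = v"
    have "(\<exists>A\<in>P. u \<in> A \<and> v \<in> A) \<longleftrightarrow> u = v" if u: "u \<in> ?V" for u v
    proof -
      obtain A where "A \<in> P" "u \<in> A" using u partition_onD1[OF P] by blast
      then show ?thesis using trivial by metis
    qed
    then show "parcs F = {(u, v). u \<in> ?V \<and> v \<in> ?V \<and> u \<noteq> v}"
      unfolding E by (simp cong: conj_cong)
  next
    assume eq: "parcs F = {(u, v). u \<in> ?V \<and> v \<in> ?V \<and> u \<noteq> v}"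
    show "\<forall>A\<in>P. \<forall>u\<in>A. \<forall>v\<in>A. u = v"
    proof (intro ballI)
      fix A u v assume A: "A \<in> P" "u \<in> A" "v \<in> A"
      then have "u \<in> ?V" "v \<in> ?V" using partition_onD1[OF P] by blast+
      moreover have "(u, v) \<notin> parcs F" using A unfolding E by blast
      ultimately show "u = v" unfolding eq by blast
    qed
  qed
  finally show ?thesis using V s by (auto simp: complete_digraph_pair_def)
qed

lemma turan_graph_complete_multipartite:
  assumes "turan_graph s r F"
  shows "complete_multipartite (pverts F) (parcs F)"
proof -
  from assms obtain P where F: "pair_graph F" and P: "partition_on (pverts F) P"
    and E: "parcs F = {(u, v). u \<in> pverts F \<and> v \<in> pverts F \<and> \<not> (\<exists>A\<in>P. u \<in> A \<and> v \<in> A)}"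
    unfolding turan_graph_def by blast
  have same: "A = B" if "A \<in> P" "B \<in> P" "v \<in> A" "v \<in> B" for A B v
    using partition_onD2[OF P] that by (auto simp: disjoint_def)
  show ?thesis
  proof
    show "finite (pverts F)"
      using F by (rule pair_fin_digraph.pair_finite_verts[OF pair_digraph.axioms(1)[OF pair_graph.axioms(1)]])
    show "(v, v) \<notin> parcs F" if "v \<in> pverts F" for v
      using that partition_onD1[OF P] unfolding E by blast
    show "(v, u) \<in> parcs F" if "(u, v) \<in> parcs F" for u v
      using that unfolding E by blast
    show "(u, w) \<notin> parcs F"
      if uvw: "u \<in> pverts F" "v \<in> pverts F" "w \<in> pverts F" and "(u, v) \<notin> parcs F" "(v, w) \<notin> parcs F" for u v w
    proof -
      from that obtain A B where "A \<in> P" "u \<in> A" "v \<in> A" "B \<in> P" "v \<in> B" "w \<in> B"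
        unfolding E by blast
      then show ?thesis using same[of A B v] unfolding E by blast
    qed
  qed
qed

text \<open>
  Part sizes differ by at most one, so a part with three vertices forces all parts to have at least two.
\<close>

lemma turan_graph_parts_cases:
  assumes F: "turan_graph s r F"
  shows "(\<forall>v\<in>pverts F. card {u \<in> pverts F. (u, v) \<notin> parcs F} \<le> 2)
    \<or> (\<forall>v\<in>pverts F. \<exists>v'\<in>pverts F. v' \<noteq> v \<and> (v, v') \<notin> parcs F)"
proof -
  from F obtain P where P: "partition_on (pverts F) P"
    and bal: "\<forall>A\<in>P. \<forall>B\<in>P. card A \<le> card B + 1"
    and E: "parcs F = {(u, v). u \<in> pverts F \<and> v \<in> pverts F \<and> \<not> (\<exists>A\<in>P. u \<in> A \<and> v \<in> A)}"
    unfolding turan_graph_def by blast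
  have part: "\<exists>A\<in>P. v \<in> A \<and> {u \<in> pverts F. (u, v) \<notin> parcs F} = A" if v: "v \<in> pverts F" for v
  proof -
    obtain A where A: "A \<in> P" "v \<in> A" using v partition_onD1[OF P] by blast
    have "B = A" if "B \<in> P" "v \<in> B" for B
      using partition_onD2[OF P] that A by (auto simp: disjoint_def)
    then have "(\<exists>B\<in>P. u \<in> B \<and> v \<in> B) \<longleftrightarrow> u \<in> A" for u using A by metis
    then have "{u \<in> pverts F. (u, v) \<notin> parcs F} = {u \<in> pverts F. u \<in> A}"
      using v unfolding E by auto
    also have "\<dots> = A" using A(1) partition_onD1[OF P] by blast
    finally have "{u \<in> pverts F. (u, v) \<notin> parcs F} = A" .
    then show ?thesis using A by (intro bexI[of _ A] conjI)
  qed
  show ?thesis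
  proof (cases "\<forall>A\<in>P. card A \<le> 2")
    case True
    have "card {u \<in> pverts F. (u, v) \<notin> parcs F} \<le> 2" if v: "v \<in> pverts F" for v
    proof -
      obtain A where "A \<in> P" "{u \<in> pverts F. (u, v) \<notin> parcs F} = A" using part[OF v] by blast
      then show ?thesis using True by simp
    qed
    then show ?thesis by blast
  next
    case False
    then obtain B where B: "B \<in> P" "3 \<le> card B" by force
    have "\<exists>v'\<in>pverts F. v' \<noteq> v \<and> (v, v') \<notin> parcs F" if v: "v \<in> pverts F" for v
    proof -
      obtain A where A: "A \<in> P" "v \<in> A" using v partition_onD1[OF P] by blast
      have "2 \<le> card A" using bal A(1) B by fastforce
      then have "\<not> A \<subseteq> {v}" using card_mono[of "{v}" A] by auto
      then obtain v' where "v' \<in> A" "v' \<noteq> v" by blast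
      moreover from this have "v' \<in> pverts F" using A(1) partition_onD1[OF P] by blast
      ultimately show ?thesis using A unfolding E by blast
    qed
    then show ?thesis by blast
  qed
qed

theorem corollary1p11:
  fixes r s :: nat and F :: "'a pair_pre_digraph"
  assumes "2 \<le> r" and "r \<le> s" and "turan_graph s r F"
  shows "(inducibility_diverse F \<longleftrightarrow> complete_digraph s (with_proj F)) \<and>
         (complete_digraph s (with_proj F) \<longleftrightarrow> r = s)"
proof -
  let ?V = "pverts F" and ?E = "parcs F"
  let ?M = "max_hom_density ?V ?E"
  define c where "c = fact (card ?V) / real (card (embeddings ?V ?E ?V ?E))"
  have F: "pair_graph F" and s: "card ?V = s" using assms(3) by (auto simp: turan_graph_def)
  have mp: "complete_multipartite ?V ?E" by (rule turan_graph_complete_multipartite[OF assms(3)])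
  interpret F: complete_multipartite ?V ?E by (rule mp)
  have s2: "2 \<le> s" using assms by simp
  have V: "?V \<noteq> {}" using s s2 by auto
  have c: "0 < c" using card_automorphisms_pos[OF F.finite_V] by (simp add: c_def)
  have ind: "inducibility k F = c * ?M (k - 1)" if "2 \<le> k" for k
    using inducibility_eq_max_hom_density[OF F mp that] by (simp add: c_def)
  have "inducibility_diverse F \<longleftrightarrow> complete_digraph s (with_proj F)"
  proof
    assume complete: "complete_digraph s (with_proj F)"
    have E: "?E = {(u, v). u \<in> ?V \<and> v \<in> ?V \<and> u \<noteq> v}"
      using complete by (auto simp: complete_digraph_pair_def)
    obtain u v where uv: "u \<in> ?V" "v \<in> ?V" "u \<noteq> v"
      using s s2 card_le_Suc0_iff_eq[OF F.finite_V] by force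
    show "inducibility_diverse F"
      unfolding inducibility_diverse_def
    proof (intro allI impI)
      fix k :: nat assume k: "2 \<le> k"
      \<comment> \<open>Chosen such that \<open>s\<^sup>2 / (m - 1)\<close> is smaller than \<open>1 / (k - 1)\<close>.\<close>
      define m where "m = s\<^sup>2 * (k - 1) + k + 1"
      have "s\<^sup>2 * (k - 1) < m - 1" using k by (simp add: m_def)
      then have "real (s\<^sup>2 * (k - 1)) < real (m - 1)" by (simp only: of_nat_less_iff)
      then have "(real s)\<^sup>2 * real (k - 1) < real (m - 1)" by (simp only: of_nat_mult of_nat_power)
      moreover have "x / q < 1 / p" if "x * p < q" "0 < p" "0 < q" for x p q :: real
        using that by (simp add: field_simps)
      moreover have "0 < k - 1" "0 < m - 1" using k by (simp_all add: m_def)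
      ultimately have frac: "(real s)\<^sup>2 / real (m - 1) < 1 / real (k - 1)"
        by (simp only: of_nat_0_less_iff)
      have "?M (k - 1) \<le> 1 - 1 / real (k - 1)"
        using k E uv by (intro max_hom_density_le_if_edge[OF F.finite_V _ uv]) auto
      also have "\<dots> < 1 - (real s)\<^sup>2 / real (m - 1)"
        using frac by (rule diff_strict_left_mono)
      also have "\<dots> \<le> ?M (m - 1)"
        using max_hom_density_ge_if_complete[OF F.finite_V E \<open>0 < m - 1\<close>] by (simp only: s)
      finally have "?M (k - 1) < ?M (m - 1)" .
      then have "inducibility k F < inducibility m F"
        using ind[OF k] ind[of m] c k by (simp add: m_def)
      moreover have "k < m" by (simp add: m_def)
      ultimately show "\<exists>m>k. inducibility k F < inducibility m F" by blast
    qed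
  next
    assume diverse: "inducibility_diverse F"
    show "complete_digraph s (with_proj F)"
    proof (rule ccontr)
      assume not_complete: "\<not> complete_digraph s (with_proj F)"
      have "\<exists>u\<in>?V. \<exists>v\<in>?V. u \<noteq> v \<and> (u, v) \<notin> ?E"
      proof (rule ccontr)
        assume none: "\<not> ?thesis"
        interpret FG: pair_graph F by (rule F)
        have "(u, v) \<in> ?E \<longleftrightarrow> (u, v) \<in> ?V \<times> ?V \<and> u \<noteq> v" for u v
          using none F.irrefl_E[of u] FG.in_arcsD1[of u v] FG.in_arcsD2[of u v] by auto
        then have "?E = {(u, v). (u, v) \<in> ?V \<times> ?V \<and> u \<noteq> v}" by auto
        then show False using not_complete s F.finite_V by (simp add: complete_digraph_pair_def)
      qed
      then obtain u v where uv: "u \<in> ?V" "v \<in> ?V" "u \<noteq> v" "(u, v) \<notin> ?E" by blast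
      have "\<exists>N0\<ge>1. \<forall>N. N0 \<le> N \<longrightarrow> ?M N \<le> ?M N0"
        using turan_graph_parts_cases[OF assms(3)]
      proof
        assume "\<forall>v\<in>?V. card {u \<in> ?V. (u, v) \<notin> ?E} \<le> 2"
        then show ?thesis using uv by (intro F.max_hom_density_stable_if_parts_small) auto
      next
        assume "\<forall>v\<in>?V. \<exists>v'\<in>?V. v' \<noteq> v \<and> (v, v') \<notin> ?E"
        then show ?thesis using V by (intro F.max_hom_density_stable_if_parts_large) auto
      qed
      then obtain N0 where N0: "1 \<le> N0" "\<And>N. N0 \<le> N \<Longrightarrow> ?M N \<le> ?M N0" by blast
      obtain m where m: "Suc N0 < m" "inducibility (Suc N0) F < inducibility m F"
        using diverse N0(1) unfolding inducibility_diverse_def by (metis Suc_1 Suc_le_mono)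
      have "c * ?M N0 < c * ?M (m - 1)" using m ind[of "Suc N0"] ind[of m] N0(1) by simp
      moreover have "?M (m - 1) \<le> ?M N0" using m(1) by (intro N0(2)) simp
      ultimately show False using c by simp
    qed
  qed
  then show ?thesis using turan_graph_complete_iff[OF assms(3)] by blast
qed

end
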